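(* Let $F=(F_1,\dots,F_m):[B(\mathcal H)^n]_1\to[B(\mathcal H)^m]_1$ be a free holomorphic function. Let $z_k\in\mathbb B_n$ be such that $\lim_{k\to\infty}z_k=(1,0,\dots,0)\in\partial\mathbb B_n$, $\lim_{k\to\infty}F(z_k)=(1,0,\dots,0)\in\partial\mathbb B_m$, and $$\lim_{k\to\infty}\frac{1-\|F(z_k)\|^2}{1-\|z_k\|^2}=L<\infty.$$ Then the following statements hold. (i) For any $X=(X_1,\dots,X_n)\in[B(\mathcal H)^n]_1$, $$(I-F_1(X)^* )(I-F(X)F(X)^* )^{-1}(I-F_1(X))\le L\,(I-X_1^* )(I-XX^* )^{-1}(I-X_1).$$ (ii) If $0<c<1$, then $$F({\bf E}_c)\subset{\bf E}_\gamma,\qquad\text{where }\gamma:=\frac{Lc}{1+Lc-c}.$$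
   Context: $\mathcal H$ is a separable infinite dimensional Hilbert space. For $X=(X_1,\dots,X_n)\in B(\mathcal H)^n$, viewed as a row operator, $XX^*=\sum_iX_iX_i^*$, $\|X\|=\|XX^*\|^{1/2}$, and $[B(\mathcal H)^n]_1=\{X:\|X\|<1\}$. $\mathbb B_n$ is the open Euclidean unit ball of $\mathbb C^n$, $\partial\mathbb B_n$ its boundary. $\mathbb F_n^+$ is the unital free semigroup on $g_1,\dots,g_n$; for $\alpha=g_{i_1}\cdots g_{i_k}$ put $|\alpha|=k$, $X_\alpha=X_{i_1}\cdots X_{i_k}$ ($X_\alpha=I$ for the neutral element, of length $0$). $F=(F_1,\dots,F_m)$ is free holomorphic if each $F_j:[B(\mathcal H)^n]_1\to B(\mathcal H)$ has the form $F_j(X)=\sum_{k=0}^\infty\sum_{|\alpha|=k}a_\alpha^{(j)}X_\alpha$, $a^{(j)}_\alpha\in\mathbb C$, the series in $k$ converging in operator norm for all $X\in[B(\mathcal H)^n]_1$. For $z\in\mathbb B_n$ (identified with $(z_1I,\dots,z_nI)$), $F(z)$ is identified with a vector in $\mathbb C^m$, $\|F(z)\|$ being its Euclidean norm. For selfadjoint operators, $A<B$ means that $B-A$ is positive and invertible. For $0<c<1$ the noncommutative ellipsoid with center $((1-c)I,0,\dots,0)$ is $${\bf E}_c=\Big\{(X_1,\dots,X_n)\in B(\mathcal H)^n:\ \frac{[X_1-(1-c)I][X_1^*-(1-c)I]}{c^2}+\frac{X_2X_2^*}{c}+\cdots+\frac{X_nX_n^*}{c}<I\Big\};$$ ${\bf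 E}_\gamma$ is the analogous subset of $B(\mathcal H)^m$ (with $m$ in place of $n$ and $\gamma$ in place of $c$). *)

theory Defs
  imports "HOL-Analysis.Analysis"
begin

text \<open>Complex Hilbert spaces. The norm and the topology are those of the library class
  \<open>real_inner\<close>, whose inner product is the real part of the complex one; \<open>cinner\<close> is linear in its
  first argument.\<close>

class complex_hilbert = real_inner + complete_space +
  fixes scaleC :: "complex \<Rightarrow> 'a \<Rightarrow> 'a"  (infixr "*\<^sub>C" 75)
    and cinner :: "'a \<Rightarrow> 'a \<Rightarrow> complex"
  assumes scaleC_add_right: "c *\<^sub>C (x + y) = c *\<^sub>C x + c *\<^sub>C y"
    and scaleC_add_left: "(c + d) *\<^sub>C x = c *\<^sub>C x + d *\<^sub>C x"
    and scaleC_scaleC: "c *\<^sub>C d *\<^sub>C x = (c * d) *\<^sub>C x"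
    and scaleC_one: "1 *\<^sub>C x = x"
    and scaleC_of_real: "complex_of_real r *\<^sub>C x = r *\<^sub>R x"
    and cinner_add_left: "cinner (x + y) u = cinner x u + cinner y u"
    and cinner_scaleC_left: "cinner (c *\<^sub>C x) y = c * cinner x y"
    and cinner_commute: "cinner x y = cnj (cinner y x)"
    and Re_cinner: "Re (cinner x y) = inner x y"

interpretation complex_vector: vector_space "scaleC :: complex \<Rightarrow> 'a \<Rightarrow> 'a::complex_hilbert"
  by unfold_locales
    (simp_all add: scaleC_add_right scaleC_add_left scaleC_scaleC scaleC_one)

lemma cinner_self: "cinner x x = complex_of_real ((norm x)\<^sup>2)" for x :: "'a::complex_hilbert"
proof (rule complex_eqI)
  show "Re (cinner x x) = Re (complex_of_real ((norm x)\<^sup>2))"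
    by (simp add: Re_cinner power2_norm_eq_inner)
  have "Im (cinner x x) = - Im (cinner x x)"
    using arg_cong[OF cinner_commute[of x x], of Im] by simp
  then show "Im (cinner x x) = Im (complex_of_real ((norm x)\<^sup>2))"
    by simp
qed

lemma norm_scaleC: "norm (c *\<^sub>C x) = cmod c * norm x" for x :: "'a::complex_hilbert"
proof -
  have "cinner (c *\<^sub>C x) (c *\<^sub>C x) = c * cnj c * cinner x x"
    by (metis cinner_commute cinner_scaleC_left complex_cnj_mult mult.assoc mult.commute)
  also have "\<dots> = complex_of_real ((cmod c * norm x)\<^sup>2)"
    by (simp add: cinner_self complex_norm_square[symmetric] power_mult_distrib)
  finally have "complex_of_real ((norm (c *\<^sub>C x))\<^sup>2) = complex_of_real ((cmod c * norm x)\<^sup>2)"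
    by (simp only: cinner_self)
  then have "(norm (c *\<^sub>C x))\<^sup>2 = (cmod c * norm x)\<^sup>2"
    by (simp only: of_real_eq_iff)
  then show ?thesis
    by (simp add: power2_eq_iff_nonneg)
qed

definition separable_infinite_dim :: "'h::complex_hilbert itself \<Rightarrow> bool"
  where "separable_infinite_dim _ \<longleftrightarrow>
    separable_space (euclidean :: 'h topology) \<and>
    \<not> (\<exists>B :: 'h set. finite B \<and> complex_vector.span B = UNIV)"


text \<open>The library type \<open>'h \<Rightarrow>\<^sub>L 'h\<close> consists of the bounded real-linear maps; \<open>BH\<close> is the
  set of the complex-linear ones among them.\<close>

type_synonym 'h op = "'h \<Rightarrow>\<^sub>L 'h"

definition BH :: "'h::complex_hilbert op set"
  where "BH = {T. \<forall>c x. blinfun_apply T (c *\<^sub>C x) = c *\<^sub>C blinfun_apply T x}"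

text \<open>The operator \<open>c I\<close>; the complex multiple \<open>c T\<close> is \<open>scalar_op c o\<^sub>L T\<close>.\<close>

lift_definition scalar_op :: "complex \<Rightarrow> 'h::complex_hilbert op" is "\<lambda>c x. c *\<^sub>C x"
proof
  fix c :: complex and x y :: 'h and r :: real
  show "c *\<^sub>C (x + y) = c *\<^sub>C x + c *\<^sub>C y"
    by (rule scaleC_add_right)
  show "c *\<^sub>C r *\<^sub>R x = r *\<^sub>R c *\<^sub>C x"
    by (simp add: scaleC_of_real[symmetric] scaleC_scaleC mult.commute)
  show "\<exists>K. \<forall>x::'h. norm (c *\<^sub>C x) \<le> norm x * K"
    by (metis norm_scaleC mult.commute order_refl)
qed

definition adj :: "'h::complex_hilbert op \<Rightarrow> 'h op"
  where "adj T = (THE S. \<forall>x y. cinner (blinfun_apply T x) y = cinner x (blinfun_apply S y))"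

definition inverse_pair :: "'h::complex_hilbert op \<Rightarrow> 'h op \<Rightarrow> bool"
  where "inverse_pair T S \<longleftrightarrow> S \<in> BH \<and> T o\<^sub>L S = id_blinfun \<and> S o\<^sub>L T = id_blinfun"

definition op_invertible :: "'h::complex_hilbert op \<Rightarrow> bool"
  where "op_invertible T \<longleftrightarrow> (\<exists>S. inverse_pair T S)"

definition op_inv :: "'h::complex_hilbert op \<Rightarrow> 'h op"
  where "op_inv T = (THE S. inverse_pair T S)"

definition positive_op :: "'h::complex_hilbert op \<Rightarrow> bool"
  where "positive_op T \<longleftrightarrow> T \<in> BH \<and> (\<forall>x. cinner (blinfun_apply T x) x \<in> \<real>\<^sub>\<ge>\<^sub>0)"

definition op_le :: "'h::complex_hilbert op \<Rightarrow> 'h op \<Rightarrow> bool"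
  where "op_le A B \<longleftrightarrow> positive_op (B - A)"

definition op_less :: "'h::complex_hilbert op \<Rightarrow> 'h op \<Rightarrow> bool"
  where "op_less A B \<longleftrightarrow> positive_op (B - A) \<and> op_invertible (B - A)"


text \<open>An \<open>n\<close>-tuple of operators is a vector over a finite index type \<open>'n\<close> with \<open>n\<close> elements. The
  class \<open>one\<close> only singles out the first index, so that \<open>X $ 1\<close> is \<open>X\<^sub>1\<close> and \<open>axis 1 1\<close> is
  \<open>(1, 0, \<dots>, 0)\<close>; the numeral types \<open>1\<close>, \<open>2\<close>, \<open>3\<close>, \<dots> supply such an index type for every
  \<open>n \<ge> 1\<close>. The library norm on \<open>'h op ^ 'n\<close> is not the row operator norm and is not used.\<close>

definition row_sq :: "'h::complex_hilbert op ^ 'n::finite \<Rightarrow> 'h op"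
  where "row_sq X = (\<Sum>i\<in>UNIV. X $ i o\<^sub>L adj (X $ i))"

definition row_norm :: "'h::complex_hilbert op ^ 'n::finite \<Rightarrow> real"
  where "row_norm X = sqrt (norm (row_sq X))"

definition op_ball :: "('h::complex_hilbert op ^ 'n::finite) set"
  where "op_ball = {X. (\<forall>i. X $ i \<in> BH) \<and> row_norm X < 1}"

text \<open>Elements of the free semigroup are words, i.e. lists over the index type.\<close>

primrec word_op :: "'h::complex_hilbert op ^ 'n::finite \<Rightarrow> 'n list \<Rightarrow> 'h op"
  where
    "word_op X [] = id_blinfun"
  | "word_op X (i # \<alpha>) = X $ i o\<^sub>L word_op X \<alpha>"

definition free_holomorphic ::
    "('h::complex_hilbert op ^ 'n::finite \<Rightarrow> 'h op ^ 'm::finite) \<Rightarrow> bool"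
  where "free_holomorphic F \<longleftrightarrow>
    (\<exists>a :: 'm \<Rightarrow> 'n list \<Rightarrow> complex. \<forall>j. \<forall>X\<in>op_ball.
      (\<lambda>k. \<Sum>\<alpha> | length \<alpha> = k. scalar_op (a j \<alpha>) o\<^sub>L word_op X \<alpha>) sums (F X $ j))"

definition scalar_tuple :: "complex ^ 'n::finite \<Rightarrow> 'h::complex_hilbert op ^ 'n"
  where "scalar_tuple z = (\<chi> i. scalar_op (z $ i))"

text \<open>\<open>F(z)\<close> as a vector of \<open>\<complex>\<^sup>m\<close>; its norm is then the library (Euclidean) norm.\<close>

definition at_scalar ::
    "('h::complex_hilbert op ^ 'n::finite \<Rightarrow> 'h op ^ 'm::finite) \<Rightarrow> complex ^ 'n \<Rightarrow> complex ^ 'm"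
  where "at_scalar F z = the_inv scalar_tuple (F (scalar_tuple z))"

definition ellipsoid :: "real \<Rightarrow> ('h::complex_hilbert op ^ 'n::{finite,one}) set"
  where "ellipsoid c = {X. (\<forall>i. X $ i \<in> BH) \<and>
    op_less
      ((1 / c\<^sup>2) *\<^sub>R ((X $ 1 - (1 - c) *\<^sub>R id_blinfun) o\<^sub>L (adj (X $ 1) - (1 - c) *\<^sub>R id_blinfun))
        + (\<Sum>i\<in>UNIV - {1}. (1 / c) *\<^sub>R (X $ i o\<^sub>L adj (X $ i))))
      id_blinfun}"

end

theory Submission
  imports Defs
begin

text \<open>The operator inequality is the boundary limit of a Schwarz-Pick inequality. For \<open>Y = F X\<close>, a
  point \<open>a\<close> of the ball and \<open>b = F a\<close>, one expects
  \<open>(I - b Y\<^sup>*) (I - Y Y\<^sup>*)\<^sup>-\<^sup>1 (I - Y b\<^sup>*) / (1 - \<parallel>b\<parallel>\<^sup>2)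
    \<le> (I - a X\<^sup>*) (I - X X\<^sup>*)\<^sup>-\<^sup>1 (I - X a\<^sup>*) / (1 - \<parallel>a\<parallel>\<^sup>2)\<close>,
  where \<open>X a\<^sup>*\<close> is the sum of the \<open>X\<^sub>i\<close> weighted with the conjugates of the \<open>a\<^sub>i\<close>. With
  \<open>a = z\<^sub>k\<close> and \<open>k \<longrightarrow> \<infinity>\<close> the weighted sums tend to \<open>X\<^sub>1\<close> and \<open>Y\<^sub>1\<close>, and the quotient of the
  scalar factors tends to \<open>L\<close>.

  At a vector \<open>p\<close> this follows from one application of the hypothesis that \<open>F\<close> maps the row ball
  to the row ball. The direct sum of \<open>X\<close> with the scalar row \<open>a\<close> acts on \<open>H \<oplus> \<complex>\<close>, which is
  identified with \<open>H\<close> by an isometry with one-dimensional cokernel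
  (\<open>ex_corank_one_isometry\<close>; this is where the infinite dimension enters). Conjugate it by a shear
  with parameter a multiple \<open>u\<close> of \<open>p\<close>. As free power series respect direct sums and similarities,
  \<open>F\<close> maps the result to the sheared direct sum of \<open>Y\<close> and \<open>b\<close>
  (\<open>free_holomorphic_extend_row\<close>). By a Schur complement, such a row is a strict contraction
  precisely when a scalar inequality between \<open>(I - X X\<^sup>*)\<^sup>-\<^sup>1\<close> at the vector \<open>(I - X a\<^sup>*) u\<close> and
  \<open>(1 - \<parallel>a\<parallel>\<^sup>2) (1 + \<parallel>u\<parallel>\<^sup>2)\<close> holds (\<open>defect_extend_row\<close>). Comparing the inequalities for
  \<open>X, a\<close> and for \<open>Y, b\<close> gives \<open>Schwarz_Pick_at_scalar\<close>: the displayed inequality with the right hand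
  form replaced by any number above both it and \<open>\<parallel>p\<parallel>\<^sup>2\<close>, which is enough because
  \<open>\<parallel>p\<parallel>\<^sup>2\<close> is weighted with \<open>1 - \<parallel>z\<^sub>k\<parallel>\<^sup>2\<close> in the limit.

  The ellipsoid of parameter \<open>c\<close> is the set where \<open>(1 - c) (I - X\<^sub>1) (I - X\<^sub>1)\<^sup>* < c (I - X X\<^sup>*)\<close>
  (\<open>ellipsoid_iff\<close>), and for positive invertible \<open>A\<close> the inequalities \<open>B B\<^sup>* \<le> k A\<close> and
  \<open>B\<^sup>* A\<^sup>-\<^sup>1 B \<le> k I\<close> are equivalent (\<open>inverse_form_le_iff\<close>). The operator inequality thus sends the
  parameter \<open>k = c / (1 - c)\<close> to \<open>L k = \<gamma> / (1 - \<gamma>)\<close>.\<close>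

section \<open>Complex Hilbert spaces and adjoints\<close>

instance complex_hilbert \<subseteq> banach ..

lemma cinner_add_right: "cinner x (y + u) = cinner x y + cinner x u"
  for x :: "'a::complex_hilbert"
  by (metis cinner_commute cinner_add_left complex_cnj_add)

lemma cinner_scaleC_right: "cinner x (c *\<^sub>C y) = cnj c * cinner x y"
  for x :: "'a::complex_hilbert"
  by (metis cinner_commute cinner_scaleC_left complex_cnj_mult)

lemma Im_cinner: "Im (cinner x y) = - inner (\<i> *\<^sub>C x) y" for x :: "'a::complex_hilbert"
  by (simp add: Re_cinner[symmetric] cinner_scaleC_left)

text \<open>The real inner product determines the complex one, because its value at \<open>\<i> x\<close> is the imaginary
  part up to sign. Identities and estimates for quadratic forms are therefore proved for
  \<^term>\<open>inner\<close> below and carried over when the complex form matters.\<close>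

lemma cinner_eq_iff_inner_eq:
  fixes S T :: "'a::complex_hilbert \<Rightarrow> 'b::complex_hilbert"
  assumes "\<And>c x. S (c *\<^sub>C x) = c *\<^sub>C S x" "\<And>x. inner (S x) y = inner x w"
  shows "cinner (S x) y = cinner x w"
  by (rule complex_eqI) (simp_all add: Re_cinner Im_cinner assms(1)[symmetric] assms(2))

lemma cinner_norm_le: "cmod (cinner x y) \<le> norm x * norm y" for x :: "'a::complex_hilbert"
proof (cases "cinner x y = 0")
  case False
  define c where "c = cnj (cinner x y) / cmod (cinner x y)"
  have c: "cmod c = 1"
    using False by (simp add: c_def norm_divide)
  have "c * cinner x y = cmod (cinner x y)"
    using False complex_norm_square[of "cinner x y"]
    by (simp add: c_def power2_eq_square mult.commute field_simps)
  then have "cmod (cinner x y) = Re (cinner (c *\<^sub>C x) y)"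
    by (simp add: cinner_scaleC_left)
  also have "\<dots> \<le> norm (c *\<^sub>C x) * norm y"
    unfolding Re_cinner by (rule norm_cauchy_schwarz)
  finally show ?thesis
    by (simp add: norm_scaleC c)
qed simp

lemma bounded_bilinear_cinner: "bounded_bilinear (cinner :: 'a::complex_hilbert \<Rightarrow> _)"
proof
  fix r :: real and x y :: 'a
  show "cinner (r *\<^sub>R x) y = r *\<^sub>R cinner x y"
    by (simp add: scaleC_of_real[symmetric] cinner_scaleC_left scaleR_conv_of_real)
  show "cinner x (r *\<^sub>R y) = r *\<^sub>R cinner x y"
    by (simp add: scaleC_of_real[symmetric] cinner_scaleC_right scaleR_conv_of_real)
  show "\<exists>K. \<forall>a b::'a. norm (cinner a b) \<le> norm a * norm b * K"
    by (rule exI[of _ 1]) (simp add: cinner_norm_le)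
qed (simp_all add: cinner_add_left cinner_add_right)

interpretation cinner: bounded_bilinear "cinner :: 'a::complex_hilbert \<Rightarrow> _"
  by (rule bounded_bilinear_cinner)

lemma bounded_bilinear_scaleC: "bounded_bilinear (scaleC :: complex \<Rightarrow> 'a::complex_hilbert \<Rightarrow> 'a)"
proof
  fix r :: real and c :: complex and x :: 'a
  show "(r *\<^sub>R c) *\<^sub>C x = r *\<^sub>R c *\<^sub>C x"
    by (simp add: scaleC_of_real[symmetric] scaleC_scaleC scaleR_conv_of_real)
  show "c *\<^sub>C r *\<^sub>R x = r *\<^sub>R c *\<^sub>C x"
    by (simp add: scaleC_of_real[symmetric] scaleC_scaleC mult.commute)
  show "\<exists>K. \<forall>(a::complex) b::'a. norm (a *\<^sub>C b) \<le> norm a * norm b * K"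
    by (rule exI[of _ 1]) (simp add: norm_scaleC)
qed (simp_all add: scaleC_add_left scaleC_add_right)

interpretation scaleC: bounded_bilinear "scaleC :: complex \<Rightarrow> 'a::complex_hilbert \<Rightarrow> 'a"
  by (rule bounded_bilinear_scaleC)

text \<open>The representing vector minimises \<open>\<parallel>x\<parallel>\<^sup>2 - 2 f x\<close>: by the parallelogram law a minimising
  sequence is Cauchy, and the first variation at its limit \<open>y\<close> is \<open>2 (inner y x - f x)\<close>.\<close>

lemma riesz_representation:
  fixes f :: "'a::{real_inner,complete_space} \<Rightarrow> real"
  assumes "bounded_linear f"
  shows "\<exists>y. \<forall>x. f x = inner x y"
proof -
  interpret f: bounded_linear f by fact
  define q where "q x = inner x x - 2 * f x" for x
  obtain K where K: "\<And>x. norm (f x) \<le> norm x * K"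
    using f.bounded by blast
  have lower: "- K\<^sup>2 \<le> q x" for x
  proof -
    have "f x \<le> norm x * K"
      using K[of x] by simp
    moreover have "0 \<le> (norm x - K)\<^sup>2"
      by simp
    ultimately show ?thesis
      unfolding q_def power2_norm_eq_inner[symmetric] by (simp add: power2_diff)
  qed
  define m where "m = (INF x. q x)"
  have bdd: "bdd_below (range q)"
    using lower by (intro bdd_belowI[of _ "- K\<^sup>2"]) auto
  have m_le: "m \<le> q x" for x
    unfolding m_def using bdd by (simp add: cINF_lower)
  have "\<exists>x. q x < m + 1 / (real n + 1)" for n
  proof (rule ccontr)
    assume "\<not> ?thesis"
    then have "m + 1 / (real n + 1) \<le> m"
      unfolding m_def by (intro cINF_greatest) (auto simp: not_less)
    moreover have "1 / (real n + 1) > 0"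
      by simp
    ultimately show False
      by linarith
  qed
  then obtain s where s: "\<And>n. q (s n) < m + 1 / (real n + 1)"
    by metis
  have par: "(norm (x - y))\<^sup>2 = 2 * q x + 2 * q y - 4 * q ((1/2) *\<^sub>R (x + y))" for x y
    unfolding q_def power2_norm_eq_inner
    by (simp add: inner_simps f.add f.scaleR algebra_simps inner_commute)
  have "Cauchy s"
  proof (rule CauchyI)
    fix e :: real assume e: "0 < e"
    obtain N where N: "4 / (e\<^sup>2) < real N"
      using reals_Archimedean2 by blast
    have "norm (s k - s l) < e" if "k \<ge> N" "l \<ge> N" for k l
    proof -
      have N': "1 / (real j + 1) < e\<^sup>2 / 4" if "j \<ge> N" for j
      proof -
        have "4 / (e\<^sup>2) < real j + 1"
          using N that by linarith
        then show ?thesis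
          using e by (simp add: field_simps)
      qed
      have "(norm (s k - s l))\<^sup>2 < e\<^sup>2"
        using par[of "s k" "s l"] m_le[of "(1/2) *\<^sub>R (s k + s l)"] s[of k] s[of l]
          N'[OF that(1)] N'[OF that(2)] by linarith
      then show ?thesis
        using e by (simp add: power_less_imp_less_base)
    qed
    then show "\<exists>M. \<forall>k\<ge>M. \<forall>l\<ge>M. norm (s k - s l) < e"
      by blast
  qed
  then obtain y where y: "s \<longlonglongrightarrow> y"
    using Cauchy_convergent_iff convergent_def by blast
  have "(\<lambda>n. q (s n)) \<longlonglongrightarrow> q y"
    unfolding q_def by (intro tendsto_intros y f.tendsto)
  moreover have "(\<lambda>n. m + 1 / (real n + 1)) \<longlonglongrightarrow> m + 0"
    using LIMSEQ_inverse_real_of_nat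
    by (intro tendsto_intros) (simp add: inverse_eq_divide add.commute)
  ultimately have "q y \<le> m + 0"
    by (rule LIMSEQ_le) (use s less_imp_le in blast)
  then have min: "q y \<le> q x" for x
    using m_le[of x] by simp
  have "f x = inner x y" for x
  proof -
    define d where "d = inner x y - f x"
    have var: "0 \<le> 2 * t * d + t\<^sup>2 * inner x x" for t
      using min[of "y + t *\<^sub>R x"] unfolding q_def d_def
      by (simp add: inner_simps f.add f.scaleR algebra_simps inner_commute power2_eq_square)
    have "d = 0"
    proof (cases "inner x x = 0")
      case True
      then show ?thesis
        using var[of "- d"] by (simp add: d_def f.zero)
    next
      case False
      then have pos: "0 < inner x x"
        by (simp add: less_le)
      have "0 \<le> - (d\<^sup>2 / inner x x)"
        using var[of "- d / inner x x"] pos by (simp add: field_simps power2_eq_square)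
      then show ?thesis
        using pos by (simp add: divide_le_0_iff)
    qed
    then show ?thesis
      by (simp add: d_def)
  qed
  then show ?thesis
    by blast
qed

lemma BH_scaleC: "T \<in> BH \<Longrightarrow> T (c *\<^sub>C x) = c *\<^sub>C T x" for T :: "'h::complex_hilbert op"
  by (simp add: BH_def)

lemma ex_adjoint:
  fixes T :: "'h::complex_hilbert op"
  assumes T: "T \<in> BH"
  shows "\<exists>S::'h op. \<forall>x y. cinner (T x) y = cinner x (S y)"
proof -
  have "\<exists>w. \<forall>x. inner (T x) y = inner x w" for y
    by (rule riesz_representation) (intro bounded_linear_intros)
  then obtain S where S: "\<And>x y. inner (T x) y = inner x (S y)"
    by metis
  have "bounded_linear S"
  proof
    fix x y :: 'h and r :: real
    show "S (x + y) = S x + S y"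
      by (rule vector_eq_ldot[THEN iffD1]) (simp add: inner_simps S[symmetric])
    show "S (r *\<^sub>R x) = r *\<^sub>R S x"
      by (rule vector_eq_ldot[THEN iffD1]) (simp add: inner_simps S[symmetric])
    have "norm (S y) \<le> norm y * norm T" for y
    proof (cases "S y = 0")
      case False
      have "(norm (S y))\<^sup>2 = inner (T (S y)) y"
        by (simp add: S power2_norm_eq_inner)
      also have "\<dots> \<le> norm (T (S y)) * norm y"
        by (rule norm_cauchy_schwarz)
      also have "\<dots> \<le> (norm T * norm (S y)) * norm y"
        by (intro mult_right_mono norm_blinfun) simp
      finally show ?thesis
        using False by (simp add: power2_eq_square mult.assoc mult.commute)
    qed simp
    then show "\<exists>K. \<forall>x. norm (S x) \<le> norm x * K"
      by blast
  qed
  then have "\<forall>x y. cinner (T x) y = cinner x (Blinfun S y)"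
    using cinner_eq_iff_inner_eq[of "blinfun_apply T"] T S
    by (simp add: bounded_linear_Blinfun_apply BH_scaleC)
  then show ?thesis
    by blast
qed

lemma cinner_ext: "(\<And>x. cinner x y = cinner x z) \<Longrightarrow> y = z" for y :: "'h::complex_hilbert"
  by (metis Re_cinner vector_eq_ldot)

lemma cinner_adj:
  assumes "T \<in> BH"
  shows "cinner (T x) y = cinner x (adj T y)"
proof -
  have "\<exists>!S. \<forall>x y. cinner (T x) y = cinner x (blinfun_apply S y)"
    using ex_adjoint[OF assms] by (metis blinfun_eqI cinner_ext)
  from theI'[OF this] show ?thesis
    unfolding adj_def by blast
qed

lemma cinner_adj': "T \<in> BH \<Longrightarrow> cinner (adj T x) y = cinner x (T y)"
  by (metis cinner_adj cinner_commute)

lemma inner_adj: "T \<in> BH \<Longrightarrow> inner (T x) y = inner x (adj T y)"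
  by (simp add: Re_cinner[symmetric] cinner_adj)

lemma inner_adj': "T \<in> BH \<Longrightarrow> inner (adj T x) y = inner x (T y)"
  by (simp add: Re_cinner[symmetric] cinner_adj')

lemma adj_apply_eqI:
  assumes "T \<in> BH" "\<And>x. cinner (T x) y = cinner x w"
  shows "adj T y = w"
  by (rule cinner_ext) (simp add: cinner_adj[OF assms(1), symmetric] assms(2))

lemma adj_in_BH:
  assumes "T \<in> BH"
  shows "adj T \<in> BH"
proof -
  have "adj T (c *\<^sub>C x) = c *\<^sub>C adj T x" for c x
    by (rule cinner_ext) (simp add: cinner_adj[OF assms, symmetric] cinner_scaleC_right)
  then show ?thesis
    by (simp add: BH_def)
qed

lemma BH_intros:
  fixes S T :: "'h::complex_hilbert op"
  shows "id_blinfun \<in> (BH :: 'h op set)" "S \<in> BH \<Longrightarrow> T \<in> BH \<Longrightarrow> S + T \<in> BH"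
    "S \<in> BH \<Longrightarrow> T \<in> BH \<Longrightarrow> S - T \<in> BH" "S \<in> BH \<Longrightarrow> T \<in> BH \<Longrightarrow> S o\<^sub>L T \<in> BH"
    "S \<in> BH \<Longrightarrow> r *\<^sub>R S \<in> BH" "scalar_op c \<in> (BH :: 'h op set)" "(0 :: 'h op) \<in> BH"
  by (auto simp: BH_def blinfun.bilinear_simps scaleC_add_right complex_vector.scale_right_diff_distrib
      scaleC.scaleR_right scalar_op.rep_eq scaleC_scaleC mult.commute)

lemma BH_sum: "(\<And>i. i \<in> I \<Longrightarrow> f i \<in> BH) \<Longrightarrow> (\<Sum>i\<in>I. f i) \<in> (BH :: 'h::complex_hilbert op set)"
  by (induction I rule: infinite_finite_induct) (auto intro: BH_intros)

section \<open>Positive operators and their inverses\<close>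

lemma positive_op_BH: "positive_op T \<Longrightarrow> T \<in> BH"
  by (simp add: positive_op_def)

text \<open>Polarisation: the form at \<open>x + \<i> y\<close> is real, which makes the real part of the sesquilinear form
  symmetric.\<close>

lemma positive_op_symmetric:
  fixes T :: "'h::complex_hilbert op"
  assumes T: "positive_op T"
  shows "inner (T x) y = inner x (T y)"
proof -
  have im: "Im (cinner (T u) u) = 0" for u
    using T by (simp add: positive_op_def complex_nonneg_Reals_iff)
  have "Im (cinner (T (x + \<i> *\<^sub>C y)) (x + \<i> *\<^sub>C y)) = Re (cinner (T y) x) - Re (cinner (T x) y)"
    using im[of x] im[of y] BH_scaleC[OF positive_op_BH[OF T]]
    by (simp add: blinfun.add_right cinner_add_left cinner_add_right cinner_scaleC_left
        cinner_scaleC_right)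
  then show ?thesis
    using im by (simp add: Re_cinner inner_commute)
qed

lemma positive_op_nonneg: "positive_op T \<Longrightarrow> 0 \<le> inner (T x) x"
  by (simp add: positive_op_def complex_nonneg_Reals_iff Re_cinner)

lemma positive_opI:
  fixes T :: "'h::complex_hilbert op"
  assumes T: "T \<in> BH" and sym: "\<And>x y. inner (T x) y = inner x (T y)"
    and nonneg: "\<And>x. 0 \<le> inner (T x) x"
  shows "positive_op T"
proof -
  have "cinner (T x) x = cinner x (T x)" for x
    by (rule cinner_eq_iff_inner_eq) (simp_all add: BH_scaleC[OF T] sym)
  then have "cinner (T x) x = cnj (cinner (T x) x)" for x
    by (metis cinner_commute)
  from arg_cong[OF this, of Im] have "Im (cinner (T x) x) = 0" for x
    by simp
  then show ?thesis
    using T nonneg by (simp add: positive_op_def complex_nonneg_Reals_iff Re_cinner)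
qed

text \<open>The form of a positive operator is a semi-inner product. With \<open>a\<close>, \<open>b\<close>, \<open>c\<close>
  for its values, positivity at \<open>c x - b y\<close> reads \<open>0 \<le> c (a c - b\<^sup>2)\<close> and settles the case \<open>c > 0\<close>;
  \<open>a > 0\<close> is symmetric, and for \<open>a = c = 0\<close> the vector \<open>x - b y\<close> gives \<open>b = 0\<close>.\<close>

lemma positive_op_Cauchy_Schwarz:
  fixes T :: "'h::complex_hilbert op"
  assumes T: "positive_op T"
  shows "(inner (T x) y)\<^sup>2 \<le> inner (T x) x * inner (T y) y"
proof -
  define a b c where "a = inner (T x) x" and "b = inner (T x) y" and "c = inner (T y) y"
  have b': "inner (T y) x = b"
    by (metis T b_def inner_commute positive_op_symmetric)
  have q: "0 \<le> s * s * a + 2 * s * t * b + t * t * c" for s t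
    using positive_op_nonneg[OF T, of "s *\<^sub>R x + t *\<^sub>R y"] b'
    by (simp add: blinfun.bilinear_simps inner_simps a_def b_def c_def algebra_simps)
  have nonneg: "0 \<le> a" "0 \<le> c"
    using positive_op_nonneg[OF T] by (simp_all add: a_def c_def)
  have 1: "0 \<le> c * (a * c - b\<^sup>2)" "0 \<le> a * (a * c - b\<^sup>2)"
    using q[of c "- b"] q[of "- b" a] by (simp_all add: algebra_simps power2_eq_square)
  have "b\<^sup>2 \<le> a * c"
  proof (cases "a = 0 \<and> c = 0")
    case True
    then show ?thesis
      using q[of 1 "- b"] by (simp add: power2_eq_square)
  next
    case False
    then show ?thesis
      using 1 nonneg by (smt (verit) zero_le_mult_iff)
  qed
  then show ?thesis
    by (simp add: a_def b_def c_def)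
qed

text \<open>The Cauchy-Schwarz inequality for the form of \<open>T\<close>, at \<open>x\<close> and \<open>T x\<close>, turns a bound on the
  quadratic form into a bound on the norm.\<close>

lemma norm_positive_op_le:
  fixes T :: "'h::complex_hilbert op"
  assumes T: "positive_op T" and q: "0 \<le> q" "\<And>x. inner (T x) x \<le> q * (norm x)\<^sup>2"
  shows "norm T \<le> q"
proof (rule norm_blinfun_bound[OF q(1)])
  fix x
  show "norm (T x) \<le> q * norm x"
  proof (cases "T x = 0")
    case False
    have "(norm (T x))\<^sup>2 * (norm (T x))\<^sup>2 = (inner (T x) (T x))\<^sup>2"
      by (simp add: power2_norm_eq_inner[symmetric] power2_eq_square)
    also have "\<dots> \<le> inner (T x) x * inner (T (T x)) (T x)"
      by (rule positive_op_Cauchy_Schwarz[OF T])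
    also have "\<dots> \<le> (q * (norm x)\<^sup>2) * (q * (norm (T x))\<^sup>2)"
      by (intro mult_mono q positive_op_nonneg[OF T]) (simp add: q(1))
    finally have "(norm (T x))\<^sup>2 \<le> (q * norm x)\<^sup>2"
      using False by (simp add: power_mult_distrib power2_eq_square mult.assoc[symmetric])
        (simp add: mult.commute mult.left_commute)
    then show ?thesis
      by (rule power2_le_imp_le) (simp add: q(1))
  qed (simp add: q(1))
qed

interpretation blinfun_compose: bounded_bilinear
    "(o\<^sub>L) :: 'h::complex_hilbert op \<Rightarrow> 'h op \<Rightarrow> 'h op"
  by (rule bounded_bilinear_blinfun_compose)

text \<open>The inverse of \<open>I - A\<close> is the fixed point of the contraction \<open>S \<mapsto> I + A S\<close>; the fixed
  point of \<open>S \<mapsto> I + S A\<close> is a left inverse, hence the same operator.\<close>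

lemma Neumann_inverse:
  fixes A :: "'h::complex_hilbert op"
  assumes A: "A \<in> BH" and lt: "norm A < 1"
  shows "op_invertible (id_blinfun - A)"
proof -
  have "\<exists>!S. id_blinfun + (A o\<^sub>L S) = S"
  proof (rule banach_fix_type)
    show "\<forall>S S'. dist (id_blinfun + (A o\<^sub>L S)) (id_blinfun + (A o\<^sub>L S')) \<le> norm A * dist S S'"
      by (auto simp: dist_norm blinfun_compose.diff_right[symmetric] norm_blinfun_compose)
  qed (use lt in simp_all)
  then obtain S where S: "id_blinfun + (A o\<^sub>L S) = S"
    by blast
  have "\<exists>!S. id_blinfun + (S o\<^sub>L A) = S"
  proof (rule banach_fix_type)
    show "\<forall>S S'. dist (id_blinfun + (S o\<^sub>L A)) (id_blinfun + (S' o\<^sub>L A)) \<le> norm A * dist S S'"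
      by (metis add_diff_cancel_left blinfun_compose.diff_left dist_norm mult.commute
          norm_blinfun_compose)
  qed (use lt in simp_all)
  then obtain R where R: "id_blinfun + (R o\<^sub>L A) = R"
    by blast
  have S': "S x - A (S x) = x" for x
    using arg_cong[OF S, of "\<lambda>T. T x"] by (simp add: blinfun.bilinear_simps algebra_simps)
  have R': "R (x - A x) = x" for x
    using arg_cong[OF R, of "\<lambda>T. T x"] by (simp add: blinfun.bilinear_simps algebra_simps)
  have "R = S"
    by (rule blinfun_eqI) (metis R' S')
  have "S (c *\<^sub>C x) = c *\<^sub>C S x" for c x
    by (metis A BH_scaleC R' S' \<open>R = S\<close> complex_vector.scale_right_diff_distrib)
  then have "inverse_pair (id_blinfun - A) S"
    unfolding inverse_pair_def BH_def
    using S' R' \<open>R = S\<close> by (auto intro!: blinfun_eqI simp: blinfun.bilinear_simps)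
  then show ?thesis
    unfolding op_invertible_def by blast
qed

text \<open>\<^term>\<open>op_inv\<close> is a definite description; a right inverse and a left inverse agree, so it denotes.\<close>

lemma inverse_pair_op_inv:
  assumes "op_invertible T"
  shows "inverse_pair T (op_inv T)"
proof -
  have "R = S" if R: "inverse_pair T R" and S: "inverse_pair T S" for R S
  proof (rule blinfun_eqI)
    fix x
    have "R o\<^sub>L T = id_blinfun" "T o\<^sub>L S = id_blinfun"
      using R S by (simp_all add: inverse_pair_def)
    from arg_cong[OF this(1), of "\<lambda>A. A (S x)"] arg_cong[OF this(2), of "\<lambda>A. A x"]
    show "R x = S x"
      by simp
  qed
  then have "\<exists>!S. inverse_pair T S"
    using assms unfolding op_invertible_def by blast
  from theI'[OF this] show ?thesis
    unfolding op_inv_def .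
qed

lemma op_inv_apply:
  assumes "op_invertible T"
  shows "T (op_inv T x) = x" "op_inv T (T x) = x" "op_inv T \<in> BH"
proof -
  have S: "op_inv T \<in> BH" "T o\<^sub>L op_inv T = id_blinfun" "op_inv T o\<^sub>L T = id_blinfun"
    using inverse_pair_op_inv[OF assms] unfolding inverse_pair_def by auto
  show "op_inv T \<in> BH"
    by fact
  show "T (op_inv T x) = x"
    using arg_cong[OF S(2), of "\<lambda>A. A x"] by simp
  show "op_inv T (T x) = x"
    using arg_cong[OF S(3), of "\<lambda>A. A x"] by simp
qed

lemma op_inv_symmetric:
  assumes "positive_op T" "op_invertible T"
  shows "inner (op_inv T x) y = inner x (op_inv T y)"
  using positive_op_symmetric[OF assms(1), of "op_inv T x" "op_inv T y"]
  by (simp add: op_inv_apply(1)[OF assms(2)])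

lemma op_inv_nonneg:
  assumes "positive_op T" "op_invertible T"
  shows "0 \<le> inner (op_inv T x) x"
  using positive_op_nonneg[OF assms(1), of "op_inv T x"]
  by (simp add: op_inv_apply(1)[OF assms(2)] inner_commute)

text \<open>For a positive operator this is invertibility, in the form in which it is verified and used.\<close>

definition coercive :: "'h::complex_hilbert op \<Rightarrow> bool"
  where "coercive T \<longleftrightarrow> (\<exists>\<epsilon>>0. \<forall>x. \<epsilon> * (norm x)\<^sup>2 \<le> inner (T x) x)"

text \<open>A large multiple \<open>M I\<close> dominates \<open>T\<close>, and then \<open>I - T / M\<close> lies between \<open>0\<close> and
  \<open>(1 - \<epsilon> / M) I\<close>.\<close>

lemma coercive_imp_invertible:
  fixes T :: "'h::complex_hilbert op"
  assumes T: "positive_op T" and "coercive T"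
  shows "op_invertible T"
proof -
  obtain e where e: "0 < e" "\<And>x. e * (norm x)\<^sup>2 \<le> inner (T x) x"
    using \<open>coercive T\<close> unfolding coercive_def by blast
  define M where "M = norm T + e"
  have M: "0 < M" "e \<le> M"
    using e(1) by (simp_all add: M_def add_nonneg_pos)
  define A where "A = id_blinfun - (1 / M) *\<^sub>R T"
  have A_apply: "inner (A x) y = inner x y - inner (T x) y / M" for x y
    by (simp add: A_def blinfun.bilinear_simps inner_simps)
  have upper: "inner (T x) x \<le> M * (norm x)\<^sup>2" for x
  proof -
    have "inner (T x) x \<le> norm (T x) * norm x"
      by (rule norm_cauchy_schwarz)
    also have "\<dots> \<le> (norm T * norm x) * norm x"
      by (intro mult_right_mono norm_blinfun) simp
    also have "\<dots> \<le> M * (norm x)\<^sup>2"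
      using e(1) by (simp add: M_def power2_eq_square algebra_simps)
    finally show ?thesis .
  qed
  have "positive_op A"
  proof (rule positive_opI)
    show "A \<in> BH"
      using positive_op_BH[OF T] by (simp add: A_def BH_intros)
    show "inner (A x) y = inner x (A y)" for x y
      using positive_op_symmetric[OF T, of x y]
      by (simp add: A_apply) (simp add: A_def blinfun.bilinear_simps inner_simps)
    show "0 \<le> inner (A x) x" for x
      using upper[of x] M(1) by (simp add: A_apply power2_norm_eq_inner[symmetric] field_simps)
  qed
  moreover have "inner (A x) x \<le> (1 - e / M) * (norm x)\<^sup>2" for x
    using e(2)[of x] M(1) by (simp add: A_apply power2_norm_eq_inner[symmetric] field_simps)
  ultimately have "norm A \<le> 1 - e / M"
    using M by (intro norm_positive_op_le) (simp_all add: field_simps)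
  then have "norm A < 1"
    using e(1) M(1) by (smt (verit) divide_pos_pos)
  then obtain S where S: "inverse_pair (id_blinfun - A) S"
    using Neumann_inverse positive_op_BH[OF \<open>positive_op A\<close>] unfolding op_invertible_def by blast
  have "inverse_pair T ((1 / M) *\<^sub>R S)"
    using S unfolding inverse_pair_def
    by (simp add: A_def BH_intros blinfun_compose.scaleR_left blinfun_compose.scaleR_right)
  then show ?thesis
    unfolding op_invertible_def by blast
qed

text \<open>Since \<open>\<parallel>x\<parallel>\<^sup>2 = inner (T x) (T\<^sup>-\<^sup>1 x)\<close>, Cauchy-Schwarz for the form of \<open>T\<close> gives
  \<open>\<parallel>x\<parallel>\<^sup>4 \<le> inner (T x) x * inner x (T\<^sup>-\<^sup>1 x)\<close>, and the last factor is at most \<open>\<parallel>T\<^sup>-\<^sup>1\<parallel> \<parallel>x\<parallel>\<^sup>2\<close>.\<close>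

lemma invertible_imp_coercive:
  fixes T :: "'h::complex_hilbert op"
  assumes T: "positive_op T" and inv: "op_invertible T"
  shows "coercive T"
proof -
  define S where "S = op_inv T"
  define K where "K = norm S + 1"
  have K: "0 < K"
    by (simp add: K_def add_nonneg_pos)
  have "(1 / K) * (norm x)\<^sup>2 \<le> inner (T x) x" for x
  proof (cases "x = 0")
    case False
    have "(norm x)\<^sup>2 * (norm x)\<^sup>2 = (inner (T x) (S x))\<^sup>2"
      using positive_op_symmetric[OF T, of x "S x"] op_inv_apply(1)[OF inv, of x]
      by (simp add: S_def power2_norm_eq_inner[symmetric] power2_eq_square)
    also have "\<dots> \<le> inner (T x) x * inner (T (S x)) (S x)"
      by (rule positive_op_Cauchy_Schwarz[OF T])
    also have "\<dots> \<le> inner (T x) x * (K * (norm x)\<^sup>2)"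
    proof (rule mult_left_mono[OF _ positive_op_nonneg[OF T]])
      have "inner (T (S x)) (S x) = inner x (S x)"
        using op_inv_apply(1)[OF inv, of x] by (simp add: S_def)
      also have "\<dots> \<le> norm x * norm (S x)"
        by (rule norm_cauchy_schwarz)
      also have "\<dots> \<le> norm x * (norm S * norm x)"
        by (intro mult_left_mono norm_blinfun) simp
      also have "\<dots> \<le> K * (norm x)\<^sup>2"
        by (simp add: K_def power2_eq_square algebra_simps)
      finally show "inner (T (S x)) (S x) \<le> K * (norm x)\<^sup>2" .
    qed
    finally have "(norm x)\<^sup>2 * (norm x)\<^sup>2 \<le> (inner (T x) x * K) * (norm x)\<^sup>2"
      by (simp only: mult.assoc)
    then have "(norm x)\<^sup>2 \<le> inner (T x) x * K"
      by (rule mult_right_le_imp_le) (use False in simp)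
    then show ?thesis
      using K by (simp add: field_simps)
  qed simp
  then show ?thesis
    unfolding coercive_def using K by (intro exI[of _ "1 / K"]) simp
qed

lemma op_less_iff_coercive: "op_less A B \<longleftrightarrow> positive_op (B - A) \<and> coercive (B - A)"
  using coercive_imp_invertible invertible_imp_coercive unfolding op_less_def by blast

text \<open>Both sides say that \<open>A\<^sup>-\<^sup>1\<^sup>/\<^sup>2 B\<close> has norm at most \<open>\<surd>k\<close>. Square roots are avoided by the
  Cauchy-Schwarz inequality for the form of \<open>A\<close>.\<close>

lemma inverse_form_le_iff:
  fixes A B :: "'h::complex_hilbert op"
  assumes A: "positive_op A" "op_invertible A" and B: "B \<in> BH" and k: "0 \<le> k"
  shows "(\<forall>x. inner (op_inv A (B x)) (B x) \<le> k * (norm x)\<^sup>2) \<longleftrightarrow>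
    (\<forall>y. (norm (adj B y))\<^sup>2 \<le> k * inner (A y) y)"
proof (intro iffI allI)
  fix x
  assume le: "\<forall>y. (norm (adj B y))\<^sup>2 \<le> k * inner (A y) y"
  define y where "y = op_inv A (B x)"
  define t where "t = inner (op_inv A (B x)) (B x)"
  have Ay: "A y = B x"
    by (simp add: y_def op_inv_apply(1)[OF A(2)])
  have "t = inner (B x) y"
    unfolding t_def y_def by (rule inner_commute)
  then have t: "t = inner (A y) y" "t = inner x (adj B y)"
    by (simp_all only: Ay inner_adj[OF B])
  have "t\<^sup>2 \<le> (norm x)\<^sup>2 * (norm (adj B y))\<^sup>2"
    using Cauchy_Schwarz_ineq[of x "adj B y"] by (simp add: t(2) power2_norm_eq_inner)
  also have "\<dots> \<le> (norm x)\<^sup>2 * (k * t)"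
    using le by (intro mult_left_mono) (simp_all add: t(1))
  finally have "t * t \<le> (k * (norm x)\<^sup>2) * t"
    by (simp add: power2_eq_square mult_ac)
  moreover have "0 \<le> t"
    using positive_op_nonneg[OF A(1)] by (simp add: t(1))
  ultimately show "inner (op_inv A (B x)) (B x) \<le> k * (norm x)\<^sup>2"
    using k unfolding t_def[symmetric] by (cases "t = 0") (simp_all add: mult_le_cancel_right)
next
  fix y
  assume le: "\<forall>x. inner (op_inv A (B x)) (B x) \<le> k * (norm x)\<^sup>2"
  define x where "x = adj B y"
  define w where "w = op_inv A (B x)"
  have Aw: "A w = B x"
    by (simp add: w_def op_inv_apply(1)[OF A(2)])
  have "(norm x)\<^sup>2 * (norm x)\<^sup>2 = (inner (A w) y)\<^sup>2"
    by (simp add: Aw inner_adj[OF B] x_def[symmetric] power2_norm_eq_inner[symmetric] power2_eq_square)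
  also have "\<dots> \<le> inner (A w) w * inner (A y) y"
    by (rule positive_op_Cauchy_Schwarz[OF A(1)])
  also have "\<dots> \<le> (k * (norm x)\<^sup>2) * inner (A y) y"
  proof (intro mult_right_mono positive_op_nonneg[OF A(1)])
    have "inner (A w) w = inner (op_inv A (B x)) (B x)"
      unfolding Aw by (simp add: w_def inner_commute)
    then show "inner (A w) w \<le> k * (norm x)\<^sup>2"
      using le by simp
  qed
  finally have "(norm x)\<^sup>2 * (norm x)\<^sup>2 \<le> (k * inner (A y) y) * (norm x)\<^sup>2"
    by (simp add: mult_ac)
  then have "(norm x)\<^sup>2 \<le> k * inner (A y) y \<or> x = 0"
    by (metis mult_right_le_imp_le zero_less_norm_iff zero_less_power)
  then show "(norm (adj B y))\<^sup>2 \<le> k * inner (A y) y"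
    using k positive_op_nonneg[OF A(1), of y] unfolding x_def by auto
qed

section \<open>Row contractions\<close>

lemma row_sq_in_BH:
  assumes "\<And>i. X $ i \<in> BH"
  shows "row_sq X \<in> BH"
  unfolding row_sq_def by (intro BH_sum BH_intros assms adj_in_BH)

lemma inner_row_sq:
  assumes "\<And>i. X $ i \<in> BH"
  shows "inner (row_sq X x) y = (\<Sum>i\<in>UNIV. inner (adj (X $ i) x) (adj (X $ i) y))"
  by (simp add: row_sq_def blinfun.sum_left inner_sum_left inner_adj[OF assms])

lemma positive_row_sq:
  assumes "\<And>i. X $ i \<in> BH"
  shows "positive_op (row_sq X)"
proof (rule positive_opI[OF row_sq_in_BH])
  show "inner (row_sq X x) y = inner x (row_sq X y)" for x y
    unfolding inner_commute[of x] inner_row_sq[OF assms] by (simp add: inner_commute)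
  show "0 \<le> inner (row_sq X x) x" for x
    by (simp add: inner_row_sq[OF assms] sum_nonneg)
qed (rule assms)

lemma op_ball_iff:
  fixes X :: "'h::complex_hilbert op ^ 'n::finite"
  shows "X \<in> op_ball \<longleftrightarrow> (\<forall>i. X $ i \<in> BH) \<and>
    (\<exists>q. 0 \<le> q \<and> q < 1 \<and> (\<forall>h. (\<Sum>i\<in>UNIV. (norm (adj (X $ i) h))\<^sup>2) \<le> q * (norm h)\<^sup>2))"
    (is "_ \<longleftrightarrow> ?BH \<and> ?R")
proof -
  have "row_norm X < 1 \<longleftrightarrow> ?R" if BH: "\<And>i. X $ i \<in> BH"
  proof -
    have form: "(\<Sum>i\<in>UNIV. (norm (adj (X $ i) h))\<^sup>2) = inner (row_sq X h) h" for h
      by (simp add: inner_row_sq[OF BH] power2_norm_eq_inner)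
    have "inner (row_sq X h) h \<le> norm (row_sq X) * (norm h)\<^sup>2" for h
    proof -
      have "inner (row_sq X h) h \<le> norm (row_sq X h) * norm h"
        by (rule norm_cauchy_schwarz)
      also have "\<dots> \<le> (norm (row_sq X) * norm h) * norm h"
        by (intro mult_right_mono norm_blinfun) simp
      finally show ?thesis
        by (simp add: power2_eq_square mult.assoc)
    qed
    then have "?R" if "norm (row_sq X) < 1"
      unfolding form using that by (intro exI[of _ "norm (row_sq X)"]) simp
    moreover have "norm (row_sq X) < 1" if ?R
      using that norm_positive_op_le[OF positive_row_sq[OF BH]] unfolding form
      by (meson le_less_trans)
    ultimately show ?thesis
      unfolding row_norm_def by auto
  qed
  then show ?thesis
    unfolding op_ball_def by blast
qed

lemma op_ball_BH: "X \<in> op_ball \<Longrightarrow> X $ i \<in> BH"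
  by (simp add: op_ball_def)

lemma defect_form:
  assumes "\<And>i. X $ i \<in> BH"
  shows "inner ((id_blinfun - row_sq X) h) h = (norm h)\<^sup>2 - (\<Sum>i\<in>UNIV. (norm (adj (X $ i) h))\<^sup>2)"
  by (simp add: blinfun.bilinear_simps inner_simps inner_row_sq[OF assms] power2_norm_eq_inner)

lemma defect_positive:
  fixes X :: "'h::complex_hilbert op ^ 'n::finite"
  assumes X: "X \<in> op_ball"
  shows "positive_op (id_blinfun - row_sq X)" "coercive (id_blinfun - row_sq X)"
    "op_invertible (id_blinfun - row_sq X)"
proof -
  note BH = op_ball_BH[OF X]
  obtain q where q: "q < 1" "\<And>h. (\<Sum>i\<in>UNIV. (norm (adj (X $ i) h))\<^sup>2) \<le> q * (norm h)\<^sup>2"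
    using X unfolding op_ball_iff by blast
  have low: "(1 - q) * (norm h)\<^sup>2 \<le> inner ((id_blinfun - row_sq X) h) h" for h
    using q(2)[of h] unfolding defect_form[OF BH] by (simp add: algebra_simps)
  show "coercive (id_blinfun - row_sq X)"
    unfolding coercive_def using low q(1) by (intro exI[of _ "1 - q"]) simp
  moreover show "positive_op (id_blinfun - row_sq X)"
  proof (rule positive_opI)
    show "id_blinfun - row_sq X \<in> BH"
      by (intro BH_intros row_sq_in_BH BH)
    show "inner ((id_blinfun - row_sq X) x) y = inner x ((id_blinfun - row_sq X) y)" for x y
      using positive_op_symmetric[OF positive_row_sq[OF BH], of x y]
      by (simp add: blinfun.bilinear_simps inner_simps)
    show "0 \<le> inner ((id_blinfun - row_sq X) h) h" for h
      by (rule order_trans[OF _ low]) (use q(1) in simp)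
  qed
  ultimately show "op_invertible (id_blinfun - row_sq X)"
    by (rule coercive_imp_invertible[rotated])
qed

text \<open>The open row ball consists of the rows whose defect \<open>I - X X\<^sup>*\<close> is bounded below. Extended
  rows and points of ellipsoids are shown to lie in the ball in this form.\<close>

lemma op_ball_iff_coercive:
  fixes X :: "'h::complex_hilbert op ^ 'n::finite"
  shows "X \<in> op_ball \<longleftrightarrow> (\<forall>i. X $ i \<in> BH) \<and> coercive (id_blinfun - row_sq X)"
proof
  assume X: "X \<in> op_ball"
  then show "(\<forall>i. X $ i \<in> BH) \<and> coercive (id_blinfun - row_sq X)"
    using defect_positive(2)[OF X] op_ball_BH by blast
next
  assume X: "(\<forall>i. X $ i \<in> BH) \<and> coercive (id_blinfun - row_sq X)"
  then obtain d where d: "0 < d" "\<And>h. d * (norm h)\<^sup>2 \<le> inner ((id_blinfun - row_sq X) h) h"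
    unfolding coercive_def by blast
  have "(\<Sum>i\<in>UNIV. (norm (adj (X $ i) h))\<^sup>2) \<le> max 0 (1 - d) * (norm h)\<^sup>2" for h
  proof -
    have "(\<Sum>i\<in>UNIV. (norm (adj (X $ i) h))\<^sup>2) \<le> (1 - d) * (norm h)\<^sup>2"
      using d(2)[of h] X by (simp add: defect_form algebra_simps)
    also have "\<dots> \<le> max 0 (1 - d) * (norm h)\<^sup>2"
      by (intro mult_right_mono) simp_all
    finally show ?thesis .
  qed
  then show "X \<in> op_ball"
    unfolding op_ball_iff using X d(1) by (intro conjI exI[of _ "max 0 (1 - d)"]) auto
qed

section \<open>An isometry with one-dimensional cokernel\<close>

lemma ex_unit_vector_orthogonal:
  fixes B :: "'h::complex_hilbert set"
  assumes inf: "separable_infinite_dim TYPE('h)" and fin: "finite B"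
    and B: "\<And>b b'. b \<in> B \<Longrightarrow> b' \<in> B \<Longrightarrow> cinner b b' = (if b = b' then 1 else 0)"
  shows "\<exists>e. norm e = 1 \<and> (\<forall>b\<in>B. cinner e b = 0)"
proof -
  have "complex_vector.span B \<noteq> UNIV"
    using inf fin unfolding separable_infinite_dim_def by blast
  then obtain x where x: "x \<notin> complex_vector.span B"
    by blast
  define y where "y = x - (\<Sum>b\<in>B. cinner x b *\<^sub>C b)"
  have "(\<Sum>b\<in>B. cinner x b *\<^sub>C b) \<in> complex_vector.span B"
    by (intro complex_vector.span_sum complex_vector.span_scale complex_vector.span_base)
  then have "y \<noteq> 0"
    using x unfolding y_def by auto
  have "cinner y b = 0" if "b \<in> B" for b
  proof -
    have "(\<Sum>b'\<in>B. cinner (cinner x b' *\<^sub>C b') b) = (\<Sum>b'\<in>B. if b' = b then cinner x b else 0)"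
      by (rule sum.cong) (auto simp: cinner_scaleC_left B that)
    then show ?thesis
      using that fin by (simp add: y_def cinner.diff_left cinner.sum_left)
  qed
  then have "norm ((1 / norm y) *\<^sub>R y) = 1 \<and> (\<forall>b\<in>B. cinner ((1 / norm y) *\<^sub>R y) b = 0)"
    using \<open>y \<noteq> 0\<close> by (simp add: cinner.scaleR_left)
  then show ?thesis
    by blast
qed

definition orthonormal :: "(nat \<Rightarrow> 'h::complex_hilbert) \<Rightarrow> bool"
  where "orthonormal e \<longleftrightarrow> (\<forall>i j. cinner (e i) (e j) = (if i = j then 1 else 0))"

text \<open>Gram-Schmidt: no finite set spans, so each finite orthonormal set can be enlarged.\<close>

lemma ex_orthonormal:
  assumes inf: "separable_infinite_dim TYPE('h::complex_hilbert)"
  shows "\<exists>e :: nat \<Rightarrow> 'h. orthonormal e"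
proof -
  have "\<exists>e :: nat \<Rightarrow> 'h. \<forall>k. norm (e k) = 1 \<and> (\<forall>j<k. cinner (e k) (e j) = 0)"
  proof (rule dependent_wellorder_choice)
    fix k and f :: "nat \<Rightarrow> 'h"
    assume f: "\<And>j. j < k \<Longrightarrow> norm (f j) = 1 \<and> (\<forall>i<j. cinner (f j) (f i) = 0)"
    have "cinner (f i) (f j) = (if f i = f j then 1 else 0)" if "i < k" "j < k" for i j
    proof (cases "i = j")
      case False
      then have 0: "cinner (f i) (f j) = 0"
        using f that by (metis cinner_commute complex_cnj_zero linorder_neqE_nat)
      then have "f i \<noteq> f j"
        using f[OF that(1)] by (auto simp: cinner_self)
      then show ?thesis
        using 0 by simp
    qed (use f that in \<open>simp add: cinner_self\<close>)
    then have "\<exists>e. norm e = 1 \<and> (\<forall>b\<in>f ` {..<k}. cinner e b = 0)"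
      by (intro ex_unit_vector_orthogonal inf) auto
    then show "\<exists>e. norm e = 1 \<and> (\<forall>j<k. cinner e (f j) = 0)"
      by auto
  qed auto
  then obtain e :: "nat \<Rightarrow> 'h"
    where e: "\<And>k. norm (e k) = 1" "\<And>j k. j < k \<Longrightarrow> cinner (e k) (e j) = 0"
    by blast
  have "orthonormal e"
    unfolding orthonormal_def
  proof (intro allI)
    fix i j
    show "cinner (e i) (e j) = (if i = j then 1 else 0)"
      using e by (cases i j rule: linorder_cases)
        (simp_all add: cinner_self, metis cinner_commute complex_cnj_zero)
  qed
  then show ?thesis
    by blast
qed

lemma orthonormal_norm_sum:
  assumes f: "orthonormal f" and I: "finite I"
  shows "(norm (\<Sum>k\<in>I. c k *\<^sub>C f k))\<^sup>2 = (\<Sum>k\<in>I. (cmod (c k))\<^sup>2)"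
proof -
  have "norm (f k) = 1" for k
  proof -
    have "complex_of_real ((norm (f k))\<^sup>2) = 1"
      using f unfolding cinner_self[symmetric] by (simp add: orthonormal_def)
    then have "(norm (f k))\<^sup>2 = 1\<^sup>2"
      unfolding of_real_eq_1_iff by simp
    then show ?thesis
      by (rule power2_eq_imp_eq) simp_all
  qed
  moreover have "(norm (\<Sum>k\<in>I. c k *\<^sub>C f k))\<^sup>2 = (\<Sum>k\<in>I. (norm (c k *\<^sub>C f k))\<^sup>2)"
    using f by (intro norm_sum_Pythagorean I)
      (simp add: pairwise_def orthogonal_def orthonormal_def Re_cinner[symmetric]
        cinner_scaleC_left cinner_scaleC_right)
  ultimately show ?thesis
    by (simp add: norm_scaleC)
qed

lemma orthonormal_summable:
  assumes f: "orthonormal f" and c: "summable (\<lambda>k. (cmod (c k))\<^sup>2)"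
  shows "summable (\<lambda>k. c k *\<^sub>C f k)"
  unfolding summable_Cauchy
proof (intro allI impI)
  fix r :: real assume r: "0 < r"
  then have "0 < r\<^sup>2"
    by simp
  then obtain N where N: "\<And>m n. m \<ge> N \<Longrightarrow> norm (\<Sum>k=m..<n. (cmod (c k))\<^sup>2) < r\<^sup>2"
    using c unfolding summable_Cauchy by blast
  have "norm (\<Sum>k=m..<n. c k *\<^sub>C f k) < r" if "m \<ge> N" for m n
  proof -
    have "(norm (\<Sum>k=m..<n. c k *\<^sub>C f k))\<^sup>2 < r\<^sup>2"
      using N[OF that, of n] by (simp add: orthonormal_norm_sum[OF f])
    then show ?thesis
      using r by (simp add: power_less_imp_less_base)
  qed
  then show "\<exists>N. \<forall>m\<ge>N. \<forall>n. norm (\<Sum>k=m..<n. c k *\<^sub>C f k) < r"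
    by blast
qed

lemma orthonormal_sums_coefficient:
  assumes f: "orthonormal f" and P: "(\<lambda>k. c k *\<^sub>C f k) sums P"
  shows "cinner P (f j) = c j"
proof -
  have "(\<lambda>k. cinner (c k *\<^sub>C f k) (f j)) sums cinner P (f j)"
    by (rule bounded_linear.sums[OF cinner.bounded_linear_left P])
  moreover have "(\<lambda>k. cinner (c k *\<^sub>C f k) (f j)) = (\<lambda>k. if k = j then c k else 0)"
    using f by (auto simp: orthonormal_def cinner_scaleC_left)
  ultimately have "(\<lambda>k. if k = j then c k else 0) sums cinner P (f j)"
    by simp
  then show ?thesis
    using sums_single[of j c] sums_unique2 by blast
qed

lemma orthonormal_sums_norm:
  assumes f: "orthonormal f" and P: "(\<lambda>k. c k *\<^sub>C f k) sums P"
  shows "(\<lambda>k. (cmod (c k))\<^sup>2) sums (norm P)\<^sup>2"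
proof -
  have "(\<lambda>k. inner (c k *\<^sub>C f k) P) sums inner P P"
    by (rule bounded_linear.sums[OF bounded_linear_inner_left P])
  moreover have "inner (c k *\<^sub>C f k) P = (cmod (c k))\<^sup>2" for k
  proof -
    have "cinner (f k) P = cnj (c k)"
      using orthonormal_sums_coefficient[OF f P] by (metis cinner_commute)
    then show ?thesis
      by (simp add: Re_cinner[symmetric] cinner_scaleC_left complex_norm_square[symmetric]
          flip: of_real_power)
  qed
  ultimately show ?thesis
    by (simp add: power2_norm_eq_inner)
qed

lemma sums_cinner_zero:
  assumes "(\<lambda>k. c k *\<^sub>C f k) sums P" and "\<And>k. cinner y (f k) = 0"
  shows "cinner y P = 0"
proof -
  have "(\<lambda>k. cinner y (c k *\<^sub>C f k)) sums cinner y P"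
    by (rule bounded_linear.sums[OF cinner.bounded_linear_right assms(1)])
  then have "(\<lambda>k. 0) sums cinner y P"
    by (simp add: cinner_scaleC_right assms(2))
  then show ?thesis
    using sums_unique2 sums_zero by blast
qed

lemma Bessel_summable:
  assumes e: "orthonormal e"
  shows "summable (\<lambda>k. (cmod (cinner x (e k)))\<^sup>2)"
proof (rule summableI_nonneg_bounded)
  fix n
  define P where "P = (\<Sum>k<n. cinner x (e k) *\<^sub>C e k)"
  define s where "s = (\<Sum>k<n. (cmod (cinner x (e k)))\<^sup>2)"
  have "inner x P = s"
    unfolding P_def s_def Re_cinner[symmetric] cinner.sum_right cinner_scaleC_right
    by (simp add: cmod_power2) (simp add: power2_eq_square)
  moreover have "(norm P)\<^sup>2 = s"
    unfolding P_def s_def by (rule orthonormal_norm_sum[OF e]) simp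
  moreover have "0 \<le> (norm (x - P))\<^sup>2"
    by simp
  ultimately have "s \<le> (norm x)\<^sup>2"
    unfolding power2_norm_eq_inner by (simp add: inner_simps inner_commute)
  then show "(\<Sum>k<n. (cmod (cinner x (e k)))\<^sup>2) \<le> (norm x)\<^sup>2"
    by (simp only: s_def)
qed simp

text \<open>What is needed of a unitary identification of the Hilbert space with its direct sum with
  the complex numbers: \<open>W\<close> maps onto the orthogonal complement of the unit vector \<open>e\<close>.\<close>

definition corank_one_isometry :: "'h::complex_hilbert op \<Rightarrow> 'h \<Rightarrow> bool"
  where "corank_one_isometry W e \<longleftrightarrow> W \<in> BH \<and> cinner e e = 1 \<and> (\<forall>x. adj W (W x) = x) \<and>
    adj W e = 0 \<and> (\<forall>h. W (adj W h) = h - cinner h e *\<^sub>C e)"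

text \<open>\<open>W\<close> is the shift on the closed span of an orthonormal sequence and the identity on its
  orthogonal complement. Its range misses only the direction of the first vector of the sequence.\<close>

lemma ex_corank_one_isometry:
  assumes inf: "separable_infinite_dim TYPE('h::complex_hilbert)"
  shows "\<exists>(W :: 'h op) e. corank_one_isometry W e"
proof -
  obtain e :: "nat \<Rightarrow> 'h" where e: "orthonormal e"
    using ex_orthonormal[OF inf] by blast
  then have e': "orthonormal (\<lambda>k. e (Suc k))"
    by (simp add: orthonormal_def)
  define c where "c x k = cinner x (e k)" for x k
  define P where "P x = (\<Sum>k. c x k *\<^sub>C e k)" for x
  define Q where "Q x = (\<Sum>k. c x k *\<^sub>C e (Suc k))" for x
  define w where "w x = x - P x + Q x" for x
  have P: "(\<lambda>k. c x k *\<^sub>C e k) sums P x" for x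
    unfolding P_def c_def by (intro summable_sums orthonormal_summable e Bessel_summable)
  have Q: "(\<lambda>k. c x k *\<^sub>C e (Suc k)) sums Q x" for x
    unfolding Q_def c_def
    using orthonormal_summable[OF e' Bessel_summable[OF e]] by (rule summable_sums)
  have orth: "cinner (x - P x) (e j) = 0" for x j
    using orthonormal_sums_coefficient[OF e P, of x j] by (simp add: cinner.diff_left c_def)
  have norm_w: "norm (w x) = norm x" for x
  proof -
    have "inner (x - P x) (P x) = 0" "inner (x - P x) (Q x) = 0"
      using sums_cinner_zero[OF P orth] sums_cinner_zero[OF Q orth] by (simp_all flip: Re_cinner)
    moreover have "(norm (P x))\<^sup>2 = (norm (Q x))\<^sup>2"
      by (rule sums_unique2[OF orthonormal_sums_norm[OF e P] orthonormal_sums_norm[OF e' Q]])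
    ultimately have "(norm (w x))\<^sup>2 = (norm x)\<^sup>2"
      unfolding w_def power2_norm_eq_inner by (simp add: inner_simps inner_commute)
    then show ?thesis
      by simp
  qed
  have w_add: "w (x + y) = w x + w y" for x y
  proof -
    have "P (x + y) = P x + P y"
      by (rule sums_unique2[OF P])
        (use sums_add[OF P[of x] P[of y]] in \<open>simp add: c_def cinner_add_left scaleC_add_left\<close>)
    moreover have "Q (x + y) = Q x + Q y"
      by (rule sums_unique2[OF Q])
        (use sums_add[OF Q[of x] Q[of y]] in \<open>simp add: c_def cinner_add_left scaleC_add_left\<close>)
    ultimately show ?thesis
      by (simp add: w_def)
  qed
  have w_scaleC: "w (r *\<^sub>C x) = r *\<^sub>C w x" for r x
  proof -
    have "P (r *\<^sub>C x) = r *\<^sub>C P x"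
      by (rule sums_unique2[OF P])
        (use bounded_linear.sums[OF scaleC.bounded_linear_right[of r] P[of x]] in
          \<open>simp add: c_def cinner_scaleC_left scaleC_scaleC\<close>)
    moreover have "Q (r *\<^sub>C x) = r *\<^sub>C Q x"
      by (rule sums_unique2[OF Q])
        (use bounded_linear.sums[OF scaleC.bounded_linear_right[of r] Q[of x]] in
          \<open>simp add: c_def cinner_scaleC_left scaleC_scaleC\<close>)
    ultimately show ?thesis
      by (simp add: w_def scaleC_add_right complex_vector.scale_right_diff_distrib)
  qed
  have "bounded_linear w"
    by (rule bounded_linear_intro[of _ 1])
      (simp_all add: w_add w_scaleC norm_w flip: scaleC_of_real)
  define W where "W = Blinfun w"
  have W: "W x = w x" for x
    using \<open>bounded_linear w\<close> by (simp add: W_def bounded_linear_Blinfun_apply)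
  have BH: "W \<in> BH"
    by (simp add: BH_def W w_scaleC)
  have iso: "inner (W x) (W y) = inner x y" for x y
  proof -
    have "(norm (W (x + y)))\<^sup>2 = (norm (x + y))\<^sup>2" "(norm (W x))\<^sup>2 = (norm x)\<^sup>2"
      "(norm (W y))\<^sup>2 = (norm y)\<^sup>2"
      by (simp_all add: W norm_w)
    then show ?thesis
      unfolding power2_norm_eq_inner by (simp add: blinfun.add_right inner_simps inner_commute)
  qed
  have "cinner (W x) (W y) = cinner x y" for x y
    by (rule cinner_eq_iff_inner_eq) (simp_all add: BH_scaleC[OF BH] iso)
  then have adj_W: "adj W (W y) = y" for y
    by (intro adj_apply_eqI BH)
  have w_e: "w (e j) = e (Suc j)" for j
  proof -
    have c: "c (e j) k = (if k = j then 1 else 0)" for k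
      using e by (simp add: c_def orthonormal_def)
    have *: "(\<lambda>k. c (e j) k *\<^sub>C x k) = (\<lambda>k. if k = j then x k else 0)" for x :: "nat \<Rightarrow> 'h"
      by (auto simp: c scaleC_one)
    have "P (e j) = e j" "Q (e j) = e (Suc j)"
      using P[of "e j"] Q[of "e j"] sums_single[of j e] sums_single[of j "\<lambda>k. e (Suc k)"] sums_unique2
      unfolding * by blast+
    then show ?thesis
      by (simp add: w_def)
  qed
  have "cinner (W x) (e 0) = 0" for x
  proof -
    have "cinner (e 0) (Q x) = 0"
      by (rule sums_cinner_zero[OF Q]) (use e in \<open>simp add: orthonormal_def\<close>)
    then have "cinner (Q x) (e 0) = 0"
      by (metis cinner_commute complex_cnj_zero)
    then show ?thesis
      using orth[of x 0] by (simp add: W w_def cinner_add_left cinner.diff_left)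
  qed
  then have adj_e: "adj W (e 0) = 0"
    by (intro adj_apply_eqI BH) (simp add: cinner.zero_right)
  have kernel: "y = cinner y (e 0) *\<^sub>C e 0" if y: "adj W y = 0" for y
  proof -
    have 0: "cinner (W x) y = 0" for x
      by (simp add: cinner_adj[OF BH] y cinner.zero_right)
    have tail: "cinner y (e (Suc j)) = 0" for j
      using 0[of "e j"] by (metis W cinner_commute complex_cnj_zero w_e)
    have *: "(\<lambda>k. c y k *\<^sub>C x k) = (\<lambda>k. if k = 0 then c y 0 *\<^sub>C x k else 0)" for x :: "nat \<Rightarrow> 'h"
    proof
      fix k show "c y k *\<^sub>C x k = (if k = 0 then c y 0 *\<^sub>C x k else 0)"
        by (cases k) (simp_all add: c_def tail)
    qed
    have PQ: "P y = c y 0 *\<^sub>C e 0" "Q y = c y 0 *\<^sub>C e (Suc 0)"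
      using P[of y] Q[of y] sums_single[of 0 "\<lambda>k. c y 0 *\<^sub>C e k"]
        sums_single[of 0 "\<lambda>k. c y 0 *\<^sub>C e (Suc k)"] sums_unique2
      unfolding * by blast+
    have "cinner (e (Suc 0)) y = 0"
      using tail[of 0] by (metis cinner_commute complex_cnj_zero)
    then have "cinner y y = cinner (P y) y"
      using 0[of y] by (simp add: W w_def PQ(2) cinner_add_left cinner.diff_left cinner_scaleC_left)
    moreover have "cinner (y - P y) (P y) = 0"
      by (rule sums_cinner_zero[OF P orth])
    ultimately have "cinner (y - P y) (y - P y) = 0"
      by (simp add: cinner.diff_left cinner.diff_right)
    then show ?thesis
      using PQ(1) by (simp add: cinner_self c_def)
  qed
  have "W (adj W h) = h - cinner h (e 0) *\<^sub>C e 0" for h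
  proof -
    have "adj W (h - W (adj W h)) = 0"
      by (simp add: blinfun.diff_right adj_W)
    from kernel[OF this] have "h - W (adj W h) = cinner h (e 0) *\<^sub>C e 0"
      by (simp add: cinner.diff_left cinner_adj[OF BH] adj_e cinner.zero_right)
    then show ?thesis
      by (simp add: algebra_simps)
  qed
  moreover have "cinner (e 0) (e 0) = 1"
    using e by (simp add: orthonormal_def)
  ultimately have "corank_one_isometry W (e 0)"
    using BH adj_W adj_e by (simp add: corank_one_isometry_def)
  then show ?thesis
    by blast
qed

section \<open>Scalar tuples\<close>

lemma adj_scalar_op: "adj (scalar_op c :: 'h::complex_hilbert op) h = cnj c *\<^sub>C h"
  by (intro adj_apply_eqI BH_intros)
    (simp add: scalar_op.rep_eq cinner_scaleC_left cinner_scaleC_right)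

lemma norm_complex_vec_sq: "(norm z)\<^sup>2 = (\<Sum>i\<in>UNIV. (cmod (z $ i))\<^sup>2)" for z :: "complex ^ 'n::finite"
  by (simp add: norm_vec_def L2_set_def sum_nonneg)

lemma scalar_tuple_nth: "scalar_tuple z $ i = scalar_op (z $ i)"
  by (simp add: scalar_tuple_def)

lemma defect_scalar_tuple:
  "inner ((id_blinfun - row_sq (scalar_tuple z)) h) h = (1 - (norm z)\<^sup>2) * (norm h)\<^sup>2"
  for h :: "'h::complex_hilbert"
proof -
  have "scalar_tuple z $ i \<in> (BH :: 'h op set)" for i
    by (simp add: scalar_tuple_def BH_intros)
  then show ?thesis
    by (simp add: defect_form scalar_tuple_nth adj_scalar_op norm_scaleC power_mult_distrib
        norm_complex_vec_sq sum_distrib_left algebra_simps)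
qed

lemma scalar_tuple_in_op_ball:
  assumes "norm z < 1"
  shows "(scalar_tuple z :: 'h::complex_hilbert op ^ 'n::finite) \<in> op_ball"
proof -
  have "0 < 1 - (norm z)\<^sup>2"
    using assms by (simp add: power_less_one_iff abs_square_less_1)
  then show ?thesis
    unfolding op_ball_iff_coercive coercive_def
    by (auto simp: defect_scalar_tuple scalar_tuple_nth BH_intros intro!: exI[of _ "1 - (norm z)\<^sup>2"])
qed

lemma norm_lt_1_if_scalar_tuple_in_op_ball:
  assumes "(scalar_tuple z :: 'h::complex_hilbert op ^ 'n::finite) \<in> op_ball"
    and "cinner (e::'h) e = 1"
  shows "norm z < 1"
proof -
  obtain d where d: "0 < d"
    "\<And>h::'h. d * (norm h)\<^sup>2 \<le> inner ((id_blinfun - row_sq (scalar_tuple z)) h) h"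
    using assms(1) unfolding op_ball_iff_coercive coercive_def by blast
  have "0 < (norm e)\<^sup>2"
    using assms(2) by (auto simp: cinner.zero_left)
  moreover have "0 < d * (norm e)\<^sup>2"
    using d(1) \<open>0 < (norm e)\<^sup>2\<close> by simp
  ultimately have "0 < 1 - (norm z)\<^sup>2"
    using d(2)[of e] unfolding defect_scalar_tuple
    by (smt (verit) zero_less_mult_iff)
  then show ?thesis
    by (simp add: abs_square_less_1)
qed

lemma word_op_scalar_tuple: "\<exists>c. word_op (scalar_tuple z) \<alpha> = (scalar_op c :: 'h::complex_hilbert op)"
proof (induction \<alpha>)
  case Nil
  show ?case
    by (rule exI[of _ 1]) (auto intro!: blinfun_eqI simp: scalar_op.rep_eq scaleC_one)
next
  case (Cons i \<alpha>)
  then obtain c where c: "word_op (scalar_tuple z) \<alpha> = (scalar_op c :: 'h op)"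
    by blast
  show ?case
    by (rule exI[of _ "z $ i * c"])
      (auto intro!: blinfun_eqI simp: c scalar_tuple_nth scalar_op.rep_eq scaleC_scaleC)
qed

lemma scalar_op_sum: "(\<Sum>i\<in>I. scalar_op (c i)) = (scalar_op (\<Sum>i\<in>I. c i) :: 'h::complex_hilbert op)"
  by (rule blinfun_eqI) (simp add: scalar_op.rep_eq blinfun.sum_left complex_vector.scale_sum_left)

lemma scalar_op_sums:
  fixes S :: "'h::complex_hilbert op"
  assumes sums: "(\<lambda>k. scalar_op (c k)) sums S" and e: "cinner (e::'h) e = 1"
  shows "\<exists>s. S = scalar_op s"
proof -
  define s where "s = cinner (S e) e"
  have h: "(\<lambda>k. c k *\<^sub>C h) sums S h" for h
    using bounded_linear.sums[OF blinfun.bounded_linear_left sums, of h]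
    by (simp add: scalar_op.rep_eq)
  have "(\<lambda>k. cinner (c k *\<^sub>C e) e) sums s"
    unfolding s_def by (rule bounded_linear.sums[OF cinner.bounded_linear_left h])
  then have "c sums s"
    by (simp add: cinner_scaleC_left e)
  then have "(\<lambda>k. c k *\<^sub>C h) sums (s *\<^sub>C h)" for h :: 'h
    by (rule bounded_linear.sums[OF scaleC.bounded_linear_left])
  then have "S h = s *\<^sub>C h" for h
    using h sums_unique2 by blast
  then show ?thesis
    by (intro exI[of _ s] blinfun_eqI) (simp add: scalar_op.rep_eq)
qed

text \<open>At a scalar tuple every homogeneous term is a multiple of the identity, and such multiples form a
  closed set. Hence the value is again a scalar tuple, and the definite description in
  \<^term>\<open>at_scalar\<close> picks it.\<close>

lemma free_holomorphic_at_scalar: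
  fixes F :: "'h::complex_hilbert op ^ 'n::finite \<Rightarrow> 'h op ^ 'm::finite"
  assumes F: "free_holomorphic F" and z: "norm z < 1" and e: "cinner (e::'h) e = 1"
  shows "F (scalar_tuple z) = scalar_tuple (at_scalar F z)"
proof -
  obtain a where a: "\<And>j X. X \<in> op_ball \<Longrightarrow>
      (\<lambda>k. \<Sum>\<alpha> | length \<alpha> = k. scalar_op (a j \<alpha>) o\<^sub>L word_op X \<alpha>) sums (F X $ j)"
    using F unfolding free_holomorphic_def by blast
  have "\<exists>w. \<forall>\<alpha>. word_op (scalar_tuple z) \<alpha> = (scalar_op (w \<alpha>) :: 'h op)"
    by (intro choice allI word_op_scalar_tuple)
  then obtain w where w: "\<And>\<alpha>. word_op (scalar_tuple z) \<alpha> = (scalar_op (w \<alpha>) :: 'h op)"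
    by blast
  have comp: "scalar_op x o\<^sub>L scalar_op y = (scalar_op (x * y) :: 'h op)" for x y
    by (rule blinfun_eqI) (simp add: scalar_op.rep_eq scaleC_scaleC)
  have "\<exists>b. F (scalar_tuple z) $ j = scalar_op b" for j
    using a[OF scalar_tuple_in_op_ball[OF z], of j] unfolding w comp scalar_op_sum
    by (rule scalar_op_sums[OF _ e])
  then obtain b where b: "\<And>j. F (scalar_tuple z) $ j = scalar_op (b j)"
    by metis
  have eq: "F (scalar_tuple z) = scalar_tuple (\<chi> j. b j)"
    by (simp add: vec_eq_iff scalar_tuple_nth b)
  have "inj (scalar_tuple :: complex ^ 'm \<Rightarrow> 'h op ^ 'm)"
  proof (rule injI)
    fix x y :: "complex ^ 'm"
    assume xy: "(scalar_tuple x :: 'h op ^ 'm) = scalar_tuple y"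
    have "cinner ((scalar_tuple v $ j :: 'h op) e) e = v $ j" for v :: "complex ^ 'm" and j
      by (simp add: scalar_tuple_def scalar_op.rep_eq cinner_scaleC_left e)
    then show "x = y"
      unfolding vec_eq_iff using xy by metis
  qed
  then show ?thesis
    unfolding at_scalar_def eq by (simp add: the_inv_f_f)
qed

section \<open>Extension of a row by a scalar point\<close>

lift_definition rank_one :: "'h::complex_hilbert \<Rightarrow> 'h \<Rightarrow> 'h op" is "\<lambda>p q h. cinner h p *\<^sub>C q"
  by (intro bounded_linear_compose[OF scaleC.bounded_linear_left cinner.bounded_linear_left])

lemma rank_one_BH: "rank_one p q \<in> BH"
  by (simp add: BH_def rank_one.rep_eq cinner_scaleC_left scaleC_scaleC)

text \<open>For a unit vector \<open>e\<close> and an isometry \<open>W\<close> onto its complement put \<open>J x = W x - cinner x u *\<^sub>C e\<close> and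
  \<open>R h = cinner h (W u + e) *\<^sub>C e\<close>. Then \<open>W\<^sup>* J = I\<close>, \<open>W\<^sup>* R = 0\<close>, \<open>R J = 0\<close>, \<open>R R = R\<close> and
  \<open>J W\<^sup>* + R = I\<close>, so \<open>J A W\<^sup>* + c R\<close> is the direct sum of \<open>A\<close> and the scalar \<open>c\<close>, seen in a
  skew, non-orthogonal decomposition of the space whose obliqueness is measured by \<open>u\<close>. The scalar
  appears as an operator \<open>C\<close> so that series can be summed in both arguments.\<close>

definition extend_op ::
    "'h::complex_hilbert op \<Rightarrow> 'h \<Rightarrow> 'h \<Rightarrow> 'h op \<Rightarrow> 'h op \<Rightarrow> 'h op"
  where "extend_op W e u A C =
    ((W - rank_one u e) o\<^sub>L A o\<^sub>L adj W) + (rank_one (W u + e) e o\<^sub>L C)"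

lemma extend_op_apply:
  "extend_op W e u A C h =
    W (A (adj W h)) - cinner (A (adj W h)) u *\<^sub>C e + cinner (C h) (W u + e) *\<^sub>C e"
  by (simp add: extend_op_def blinfun.bilinear_simps rank_one.rep_eq)

lemma corank_one_isometryD:
  assumes "corank_one_isometry W e"
  shows "W \<in> BH" "cinner e e = 1" "adj W (W x) = x" "adj W e = 0"
    "W (adj W h) = h - cinner h e *\<^sub>C e"
    "cinner (W x) (W y) = cinner x y" "cinner (W x) e = 0" "cinner e (W x) = 0"
    "adj W (c *\<^sub>C x) = c *\<^sub>C adj W x"
proof -
  show W: "W \<in> BH" "cinner e e = 1" "adj W (W x) = x" "adj W e = 0" for x
    using assms by (simp_all add: corank_one_isometry_def)
  show "W (adj W h) = h - cinner h e *\<^sub>C e"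
    using assms by (simp add: corank_one_isometry_def)
  show "cinner (W x) (W y) = cinner x y" "cinner (W x) e = 0"
    by (simp_all add: cinner_adj[OF W(1)] W cinner.zero_right)
  then show "cinner e (W x) = 0"
    by (metis cinner_commute complex_cnj_zero)
  show "adj W (c *\<^sub>C x) = c *\<^sub>C adj W x"
    by (rule BH_scaleC[OF adj_in_BH[OF W(1)]])
qed

lemma extend_op_id:
  assumes "corank_one_isometry W e"
  shows "extend_op W e u id_blinfun id_blinfun = id_blinfun"
proof (rule blinfun_eqI)
  fix h
  note W = corank_one_isometryD[OF assms]
  have "cinner h (W u + e) = cinner (adj W h) u + cinner h e"
    by (simp add: cinner_add_right cinner_adj'[OF W(1)])
  then show "extend_op W e u id_blinfun id_blinfun h = id_blinfun h"
    by (simp add: extend_op_apply W scaleC_add_left)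
qed

text \<open>Multiplicativity of the direct sum, from the relations between \<open>J\<close>, \<open>R\<close> and \<open>W\<^sup>*\<close>. Only the left
  factor has a scalar corner, as for the letter that is prepended to a word.\<close>

lemma extend_op_compose:
  assumes "corank_one_isometry W e"
  shows "extend_op W e u A (scalar_op c) o\<^sub>L extend_op W e u B D
    = extend_op W e u (A o\<^sub>L B) (scalar_op c o\<^sub>L D)"
proof (rule blinfun_eqI)
  fix h
  note W = corank_one_isometryD[OF assms]
  define y where "y = extend_op W e u B D h"
  have y: "y = W (B (adj W h)) - cinner (B (adj W h)) u *\<^sub>C e + cinner (D h) (W u + e) *\<^sub>C e"
    by (simp add: y_def extend_op_apply)
  have 1: "adj W y = B (adj W h)"
    by (simp add: y blinfun.bilinear_simps W)
  have 2: "cinner (c *\<^sub>C y) (W u + e) = cinner (c *\<^sub>C D h) (W u + e)"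
    by (simp add: y cinner_add_left cinner.diff_left cinner_add_right cinner_scaleC_left W)
      (simp add: algebra_simps)
  show "(extend_op W e u A (scalar_op c) o\<^sub>L extend_op W e u B D) h
      = extend_op W e u (A o\<^sub>L B) (scalar_op c o\<^sub>L D) h"
    by (simp add: y_def[symmetric] extend_op_apply[of _ _ _ A] extend_op_apply[of _ _ _ "A o\<^sub>L B"]
        1 scalar_op.rep_eq 2)
qed

definition extend_row ::
    "'h::complex_hilbert op \<Rightarrow> 'h \<Rightarrow> 'h \<Rightarrow> 'h op ^ 'n::finite \<Rightarrow> complex ^ 'n \<Rightarrow> 'h op ^ 'n"
  where "extend_row W e u X a = (\<chi> i. extend_op W e u (X $ i) (scalar_op (a $ i)))"

lemma extend_row_nth: "extend_row W e u X a $ i = extend_op W e u (X $ i) (scalar_op (a $ i))"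
  by (simp add: extend_row_def)

lemma word_op_extend_row:
  assumes "corank_one_isometry W e"
  shows "word_op (extend_row W e u X a) \<alpha>
    = extend_op W e u (word_op X \<alpha>) (word_op (scalar_tuple a) \<alpha>)"
proof (induction \<alpha>)
  case (Cons i \<alpha>)
  then show ?case
    by (simp add: extend_row_nth scalar_tuple_nth extend_op_compose[OF assms])
qed (simp add: extend_op_id[OF assms])

lemma scalar_op_extend_op:
  assumes "corank_one_isometry W e"
  shows "scalar_op c o\<^sub>L extend_op W e u A C = extend_op W e u (scalar_op c o\<^sub>L A) (scalar_op c o\<^sub>L C)"
proof (rule blinfun_eqI)
  fix h
  note W = corank_one_isometryD[OF assms]
  show "(scalar_op c o\<^sub>L extend_op W e u A C) h
      = extend_op W e u (scalar_op c o\<^sub>L A) (scalar_op c o\<^sub>L C) h"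
    by (simp add: extend_op_apply scalar_op.rep_eq scaleC_add_right cinner_scaleC_left
        complex_vector.scale_right_diff_distrib scaleC_scaleC BH_scaleC[OF W(1)])
qed

lemma extend_op_sum:
  "extend_op W e u (\<Sum>i\<in>I. A i) (\<Sum>i\<in>I. C i) = (\<Sum>i\<in>I. extend_op W e u (A i) (C i))"
  by (simp add: extend_op_def blinfun_compose.sum_left blinfun_compose.sum_right sum.distrib)

lemma extend_op_sums:
  assumes "A sums S" "C sums R"
  shows "(\<lambda>k. extend_op W e u (A k) (C k)) sums extend_op W e u S R"
  unfolding extend_op_def
  by (intro sums_add bounded_linear.sums[OF blinfun_compose.bounded_linear_left]
      bounded_linear.sums[OF blinfun_compose.bounded_linear_right] assms)

text \<open>A free power series respects direct sums and similarities; as every word does, so does the sum of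
  the norm convergent series.\<close>

lemma free_holomorphic_extend_row:
  fixes F :: "'h::complex_hilbert op ^ 'n::finite \<Rightarrow> 'h op ^ 'm::finite"
  assumes F: "free_holomorphic F" and W: "corank_one_isometry W e"
    and X: "X \<in> op_ball" and a: "norm a < 1" and T: "extend_row W e u X a \<in> op_ball"
  shows "F (extend_row W e u X a) = extend_row W e u (F X) (at_scalar F a)"
proof -
  obtain c where c: "\<And>j X. X \<in> op_ball \<Longrightarrow>
      (\<lambda>k. \<Sum>\<alpha> | length \<alpha> = k. scalar_op (c j \<alpha>) o\<^sub>L word_op X \<alpha>) sums (F X $ j)"
    using F unfolding free_holomorphic_def by blast
  have "F (extend_row W e u X a) $ j = extend_op W e u (F X $ j) (F (scalar_tuple a) $ j)" for j
    using c[OF T, of j] extend_op_sums[OF c[OF X, of j] c[OF scalar_tuple_in_op_ball[OF a], of j]]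
    unfolding word_op_extend_row[OF W] scalar_op_extend_op[OF W] extend_op_sum
    by (rule sums_unique2)
  then show ?thesis
    by (simp add: vec_eq_iff extend_row_nth[of _ _ _ "F X"]
        free_holomorphic_at_scalar[OF F a corank_one_isometryD(2)[OF W]] scalar_tuple_nth)
qed

lemma extend_op_BH:
  assumes "corank_one_isometry W e" "A \<in> BH" "C \<in> BH"
  shows "extend_op W e u A C \<in> BH"
  unfolding extend_op_def
  by (intro BH_intros rank_one_BH adj_in_BH assms corank_one_isometryD(1)[OF assms(1)])

lemma adj_extend_op:
  assumes WW: "corank_one_isometry W e" and A: "A \<in> BH"
  shows "adj (extend_op W e u A (scalar_op c)) h =
    W (adj A (adj W h - cinner h e *\<^sub>C u)) + (cnj c * cinner h e) *\<^sub>C (W u + e)"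
proof (rule adj_apply_eqI)
  note W = corank_one_isometryD[OF WW]
  show "extend_op W e u A (scalar_op c) \<in> BH"
    by (intro extend_op_BH WW A BH_intros)
  fix x
  have he: "cinner e h = cnj (cinner h e)"
    by (rule cinner_commute)
  show "cinner (extend_op W e u A (scalar_op c) x) h =
      cinner x (W (adj A (adj W h - cinner h e *\<^sub>C u)) + (cnj c * cinner h e) *\<^sub>C (W u + e))"
    by (simp add: extend_op_apply scalar_op.rep_eq cinner_add_left cinner.diff_left cinner_add_right
        cinner.diff_right cinner_scaleC_left cinner_scaleC_right he W(9) blinfun.bilinear_simps
        cinner_adj[OF W(1), of "A (adj W x)"] cinner_adj'[OF W(1), symmetric]
        cinner_adj[OF A] BH_scaleC[OF adj_in_BH[OF A]] BH_scaleC[OF W(1)]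
        complex_vector.scale_right_diff_distrib scaleC_add_right)
qed

lemma norm_isometry_add:
  assumes "corank_one_isometry W e"
  shows "(norm (W x + c *\<^sub>C e))\<^sup>2 = (norm x)\<^sup>2 + (cmod c)\<^sup>2"
proof -
  note W = corank_one_isometryD[OF assms]
  have "cinner (W x + c *\<^sub>C e) (W x + c *\<^sub>C e) = cinner x x + c * cnj c"
    by (simp add: cinner_add_left cinner_add_right cinner_scaleC_left cinner_scaleC_right W)
  then have "complex_of_real ((norm (W x + c *\<^sub>C e))\<^sup>2) = complex_of_real ((norm x)\<^sup>2 + (cmod c)\<^sup>2)"
    by (simp only: cinner_self complex_norm_square[symmetric] of_real_add)
  then show ?thesis
    unfolding of_real_eq_iff .
qed

text \<open>This is the vector \<open>(I - X a\<^sup>*) p\<close>, where \<open>X a\<^sup>*\<close> is the product of the row \<open>X\<close> and the adjoint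
  of the scalar row \<open>a\<close>.\<close>

definition pencil :: "'h::complex_hilbert op ^ 'n::finite \<Rightarrow> complex ^ 'n \<Rightarrow> 'h \<Rightarrow> 'h"
  where "pencil X a p = p - (\<Sum>i\<in>UNIV. cnj (a $ i) *\<^sub>C (X $ i) p)"

lemma inner_scaleC_both: "inner (c *\<^sub>C x) (c *\<^sub>C y) = (cmod c)\<^sup>2 * inner x y"
  for x :: "'h::complex_hilbert"
proof -
  have "cinner (c *\<^sub>C x) (c *\<^sub>C y) = (c * cnj c) * cinner x y"
    by (simp add: cinner_scaleC_left cinner_scaleC_right)
  then show ?thesis
    unfolding complex_norm_square[symmetric] Re_cinner[symmetric]
    by (simp flip: of_real_power)
qed

text \<open>The defect of the extended row is a block form in \<open>g\<close> and the scalar \<open>l\<close>, with diagonal entries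
  \<open>I - X X\<^sup>*\<close> and \<open>(1 - \<parallel>a\<parallel>\<^sup>2) (1 + \<parallel>u\<parallel>\<^sup>2)\<close> and off-diagonal entry \<open>(I - X a\<^sup>*) u\<close>. The coordinates
  \<open>g\<close> and \<open>l\<close> of \<open>h\<close> are those of the adjoint of the skew decomposition:
  \<open>h = W (g + l u) + l e\<close>.\<close>

lemma defect_extend_row:
  fixes X :: "'h::complex_hilbert op ^ 'n::finite" and u :: 'h
  assumes WW: "corank_one_isometry W e" and X: "\<And>i. X $ i \<in> BH"
  defines "l \<equiv> \<lambda>h. cinner h e" and "g \<equiv> \<lambda>h. adj W h - cinner h e *\<^sub>C u"
  shows "inner ((id_blinfun - row_sq (extend_row W e u X a)) h) h =
    inner ((id_blinfun - row_sq X) (g h)) (g h) + 2 * inner (g h) (l h *\<^sub>C pencil X a u)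
      + (1 - (norm a)\<^sup>2) * (1 + (norm u)\<^sup>2) * (cmod (l h))\<^sup>2"
proof -
  note W = corank_one_isometryD[OF WW]
  define G s where "G = g h" and "s = l h"
  have BH: "extend_row W e u X a $ i \<in> BH" for i
    by (simp add: extend_row_nth extend_op_BH[OF WW] X BH_intros)
  have h: "h = W (G + s *\<^sub>C u) + s *\<^sub>C e"
    using W(5)[of h] by (simp add: G_def s_def g_def l_def)
  have nh: "(norm h)\<^sup>2 = (norm G)\<^sup>2 + 2 * inner G (s *\<^sub>C u) + (cmod s)\<^sup>2 * (1 + (norm u)\<^sup>2)"
  proof -
    have "(norm h)\<^sup>2 = (norm (G + s *\<^sub>C u))\<^sup>2 + (cmod s)\<^sup>2"
      by (subst h) (rule norm_isometry_add[OF WW])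
    also have "\<dots> = (norm G)\<^sup>2 + 2 * inner G (s *\<^sub>C u) + (cmod s)\<^sup>2 * (1 + (norm u)\<^sup>2)"
      by (simp add: power2_norm_eq_inner inner_simps inner_scaleC_both inner_commute algebra_simps)
    finally show ?thesis .
  qed
  have row: "(norm (adj (extend_row W e u X a $ i) h))\<^sup>2 = (norm (adj (X $ i) G))\<^sup>2
      + 2 * inner G (s *\<^sub>C cnj (a $ i) *\<^sub>C (X $ i) u)
      + (cmod (a $ i))\<^sup>2 * ((cmod s)\<^sup>2 * (1 + (norm u)\<^sup>2))" for i
  proof -
    define m where "m = cnj (a $ i) * s"
    have "adj (extend_row W e u X a $ i) h = W (adj (X $ i) G + m *\<^sub>C u) + m *\<^sub>C e"
      by (simp add: extend_row_nth adj_extend_op[OF WW X] G_def g_def m_def s_def l_def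
          blinfun.add_right scaleC_add_right BH_scaleC[OF W(1)])
    then have "(norm (adj (extend_row W e u X a $ i) h))\<^sup>2
        = (norm (adj (X $ i) G + m *\<^sub>C u))\<^sup>2 + (cmod m)\<^sup>2"
      by (simp add: norm_isometry_add[OF WW])
    also have "\<dots> = (norm (adj (X $ i) G))\<^sup>2 + 2 * inner (adj (X $ i) G) (m *\<^sub>C u)
        + (cmod m)\<^sup>2 * (1 + (norm u)\<^sup>2)"
      by (simp add: power2_norm_eq_inner inner_simps inner_scaleC_both inner_commute algebra_simps)
    also have "inner (adj (X $ i) G) (m *\<^sub>C u) = inner G (s *\<^sub>C cnj (a $ i) *\<^sub>C (X $ i) u)"
      by (simp add: inner_adj'[OF X] BH_scaleC[OF X] m_def scaleC_scaleC mult.commute)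
    also have "(cmod m)\<^sup>2 = (cmod (a $ i))\<^sup>2 * (cmod s)\<^sup>2"
      by (simp add: m_def norm_mult power_mult_distrib)
    finally show ?thesis
      by (simp add: mult.assoc)
  qed
  have "(\<Sum>i\<in>UNIV. (norm (adj (extend_row W e u X a $ i) h))\<^sup>2)
      = (\<Sum>i\<in>UNIV. (norm (adj (X $ i) G))\<^sup>2)
        + 2 * inner G (s *\<^sub>C (\<Sum>i\<in>UNIV. cnj (a $ i) *\<^sub>C (X $ i) u))
        + (norm a)\<^sup>2 * ((cmod s)\<^sup>2 * (1 + (norm u)\<^sup>2))"
    unfolding row norm_complex_vec_sq
    by (simp add: sum.distrib sum_distrib_left sum_distrib_right inner_sum_right scaleC.sum_right)
  then show ?thesis
    unfolding defect_form[OF BH] defect_form[OF X] G_def[symmetric] s_def[symmetric] nh pencil_def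
    by (simp add: complex_vector.scale_right_diff_distrib inner_simps algebra_simps)
qed


section \<open>The Schwarz-Pick inequality at a scalar point\<close>

text \<open>The Schur complement of the block form with entries \<open>A\<close> and \<open>v\<close>.\<close>

lemma complete_square:
  fixes A :: "'h::complex_hilbert op"
  assumes A: "positive_op A" "op_invertible A"
  shows "inner (A g) g + 2 * inner g (s *\<^sub>C v) + (cmod s)\<^sup>2 * inner (op_inv A v) v
    = inner (A (g + s *\<^sub>C op_inv A v)) (g + s *\<^sub>C op_inv A v)"
proof -
  have "A (s *\<^sub>C op_inv A v) = s *\<^sub>C v"
    by (simp add: BH_scaleC[OF positive_op_BH[OF A(1)]] op_inv_apply(1)[OF A(2)])
  moreover have "inner (A g) (s *\<^sub>C op_inv A v) = inner g (A (s *\<^sub>C op_inv A v))"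
    by (rule positive_op_symmetric[OF A(1)])
  moreover have "inner (s *\<^sub>C v) (s *\<^sub>C op_inv A v) = (cmod s)\<^sup>2 * inner (op_inv A v) v"
    by (simp add: inner_scaleC_both inner_commute)
  ultimately show ?thesis
    by (simp add: blinfun.add_right inner_simps inner_commute)
qed

text \<open>A strictly positive Schur complement \<open>d\<close> makes the defect of the extended row coercive: it is
  at least a multiple of \<open>\<parallel>f\<parallel>\<^sup>2 + \<bar>s\<bar>\<^sup>2\<close> in the coordinates that diagonalise the form, and these control
  \<open>\<parallel>h\<parallel>\<^sup>2\<close> up to the constant \<open>K\<close>.\<close>

lemma extend_row_in_op_ball:
  fixes X :: "'h::complex_hilbert op ^ 'n::finite"
  assumes WW: "corank_one_isometry W e" and X: "X \<in> op_ball"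
    and less: "inner (op_inv (id_blinfun - row_sq X) (pencil X a u)) (pencil X a u)
      < (1 - (norm a)\<^sup>2) * (1 + (norm u)\<^sup>2)"
  shows "extend_row W e u X a \<in> op_ball"
proof -
  note W = corank_one_isometryD[OF WW]
  define A where "A = id_blinfun - row_sq X"
  define v where "v = pencil X a u"
  define w where "w = u - op_inv A v"
  define d where "d = (1 - (norm a)\<^sup>2) * (1 + (norm u)\<^sup>2) - inner (op_inv A v) v"
  have d: "0 < d"
    using less by (simp add: d_def A_def v_def)
  note A = defect_positive[OF X, folded A_def]
  obtain r where r: "0 < r" "\<And>f. r * (norm f)\<^sup>2 \<le> inner (A f) f"
    using A(2) unfolding coercive_def by blast
  define K where "K = 2 + 2 * (norm w)\<^sup>2"
  have K: "0 < K"
    by (simp add: K_def add_pos_nonneg)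
  define m where "m = min r d / K"
  have "m * (norm h)\<^sup>2 \<le> inner ((id_blinfun - row_sq (extend_row W e u X a)) h) h" for h
  proof -
    define s where "s = cinner h e"
    define g where "g = adj W h - s *\<^sub>C u"
    define f where "f = g + s *\<^sub>C op_inv A v"
    have "h = W (f + s *\<^sub>C w) + s *\<^sub>C e"
      using W(5)[of h]
      by (simp add: f_def g_def w_def s_def complex_vector.scale_right_diff_distrib)
    then have "(norm h)\<^sup>2 = (norm (f + s *\<^sub>C w))\<^sup>2 + (cmod s)\<^sup>2"
      using norm_isometry_add[OF WW] by metis
    also have "(norm (f + s *\<^sub>C w))\<^sup>2 \<le> 2 * (norm f)\<^sup>2 + 2 * (norm (s *\<^sub>C w))\<^sup>2"
    proof -
      have "0 \<le> (norm (f - s *\<^sub>C w))\<^sup>2"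
        by simp
      then show ?thesis
        unfolding power2_norm_eq_inner by (simp add: inner_simps inner_commute)
    qed
    also have "2 * (norm f)\<^sup>2 + 2 * (norm (s *\<^sub>C w))\<^sup>2 + (cmod s)\<^sup>2
        \<le> K * ((norm f)\<^sup>2 + (cmod s)\<^sup>2)"
    proof -
      have "0 \<le> 2 * (norm w)\<^sup>2 * (norm f)\<^sup>2 + (cmod s)\<^sup>2"
        by simp
      then show ?thesis
        by (simp add: K_def norm_scaleC power_mult_distrib algebra_simps)
    qed
    finally have "m * (norm h)\<^sup>2 \<le> m * (K * ((norm f)\<^sup>2 + (cmod s)\<^sup>2))"
      using r(1) d K by (intro mult_left_mono) (simp_all add: m_def)
    also have "\<dots> = min r d * (norm f)\<^sup>2 + min r d * (cmod s)\<^sup>2"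
      using K by (simp add: m_def distrib_left)
    also have "\<dots> \<le> r * (norm f)\<^sup>2 + d * (cmod s)\<^sup>2"
      by (intro add_mono mult_right_mono) simp_all
    also have "\<dots> \<le> inner (A f) f + d * (cmod s)\<^sup>2"
      using r(2)[of f] by simp
    also have "inner (A f) f =
        inner (A g) g + 2 * inner g (s *\<^sub>C v) + (cmod s)\<^sup>2 * inner (op_inv A v) v"
      unfolding f_def by (rule complete_square[OF A(1,3), symmetric])
    also have "\<dots> + d * (cmod s)\<^sup>2 = inner ((id_blinfun - row_sq (extend_row W e u X a)) h) h"
      unfolding defect_extend_row[OF WW op_ball_BH[OF X]] A_def[symmetric] v_def[symmetric]
        s_def[symmetric] g_def[symmetric] d_def by (simp add: algebra_simps)
    finally show ?thesis .
  qed
  moreover have "0 < m"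
    using r(1) d K by (simp add: m_def)
  ultimately have "coercive (id_blinfun - row_sq (extend_row W e u X a))"
    unfolding coercive_def by blast
  then show ?thesis
    unfolding op_ball_iff_coercive
    by (simp add: extend_row_nth extend_op_BH[OF WW] op_ball_BH[OF X] BH_intros)
qed

text \<open>Evaluating the defect of the extended row at the vector that minimises it for \<open>l = 1\<close>, namely
  \<open>g = - (I - X X\<^sup>*)\<^sup>-\<^sup>1 (I - X a\<^sup>*) u\<close>, leaves exactly the Schur complement.\<close>

lemma pencil_form_le_if_extend_row_in_op_ball:
  fixes X :: "'h::complex_hilbert op ^ 'n::finite"
  assumes WW: "corank_one_isometry W e" and X: "X \<in> op_ball"
    and T: "extend_row W e u X a \<in> op_ball"
  shows "inner (op_inv (id_blinfun - row_sq X) (pencil X a u)) (pencil X a u)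
      \<le> (1 - (norm a)\<^sup>2) * (1 + (norm u)\<^sup>2)"
proof -
  note W = corank_one_isometryD[OF WW]
  define A where "A = id_blinfun - row_sq X"
  define v where "v = pencil X a u"
  note A = defect_positive[OF X, folded A_def]
  define g where "g = - op_inv A v"
  define h where "h = W (g + u) + e"
  have s: "cinner h e = 1"
    by (simp add: h_def cinner_add_left W)
  have g: "adj W h - cinner h e *\<^sub>C u = g"
    by (simp add: s) (simp add: h_def blinfun.add_right W scaleC_one)
  have "0 \<le> inner ((id_blinfun - row_sq (extend_row W e u X a)) h) h"
    by (rule positive_op_nonneg[OF defect_positive(1)[OF T]])
  also have "\<dots> = inner (A g) g + 2 * inner g (1 *\<^sub>C v) + (1 - (norm a)\<^sup>2) * (1 + (norm u)\<^sup>2)"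
    unfolding defect_extend_row[OF WW op_ball_BH[OF X]] g unfolding s A_def v_def by simp
  also have "\<dots> = (1 - (norm a)\<^sup>2) * (1 + (norm u)\<^sup>2) - inner (op_inv A v) v"
    using complete_square[OF A(1,3), of g 1 v] by (simp add: g_def scaleC_one)
  finally show ?thesis
    by (simp add: A_def v_def)
qed

lemma op_inv_form_scaleR:
  "inner (T (r *\<^sub>R x)) (r *\<^sub>R x) = r\<^sup>2 * inner (T x) x" for T :: "'h::complex_hilbert op"
  by (simp add: blinfun.scaleR_right power2_eq_square)

lemma pencil_scaleR: "pencil X a (r *\<^sub>R p) = r *\<^sub>R pencil X a p"
  by (simp add: pencil_def blinfun.scaleR_right scaleC.scaleR_right scaleR_sum_right
      scaleR_diff_right)

text \<open>The hypothesis puts the extension of \<open>X\<close> by \<open>a\<close> along a multiple \<open>u = r p\<close> into the row ball.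
  There \<open>F\<close> takes the value that is the extension of \<open>F X\<close> by \<open>F a\<close> along the same vector, and this
  value lies in the row ball as well. Both memberships are read off from Schur complements.
  The extra \<open>1\<close> in the factor \<open>1 + \<parallel>u\<parallel>\<^sup>2\<close> is responsible for the condition \<open>\<parallel>p\<parallel>\<^sup>2 < M\<close>.\<close>

lemma Schwarz_Pick_at_scalar:
  fixes F :: "'h::complex_hilbert op ^ 'n::finite \<Rightarrow> 'h op ^ 'm::finite"
  assumes inf: "separable_infinite_dim TYPE('h)" and F: "free_holomorphic F"
    and maps: "F ` op_ball \<subseteq> op_ball"
    and X: "X \<in> op_ball" and a: "norm a < 1" and M: "(norm p)\<^sup>2 < M"
    and less: "inner (op_inv (id_blinfun - row_sq X) (pencil X a p)) (pencil X a p)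
      < (1 - (norm a)\<^sup>2) * M"
  defines "b \<equiv> at_scalar F a"
  shows "inner (op_inv (id_blinfun - row_sq (F X)) (pencil (F X) b p)) (pencil (F X) b p)
      \<le> (1 - (norm b)\<^sup>2) * M"
proof -
  obtain W :: "'h op" and e where W: "corank_one_isometry W e"
    using ex_corank_one_isometry[OF inf] by blast
  \<comment> \<open>This choice of \<open>r\<close> solves \<open>1 + r\<^sup>2 \<parallel>p\<parallel>\<^sup>2 = r\<^sup>2 M\<close>.\<close>
  define r where "r = 1 / sqrt (M - (norm p)\<^sup>2)"
  define u where "u = r *\<^sub>R p"
  have r: "0 < r" "r\<^sup>2 = 1 / (M - (norm p)\<^sup>2)"
    using M by (simp_all add: r_def power_divide)
  have u: "1 + (norm u)\<^sup>2 = r\<^sup>2 * M"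
    using M by (simp add: u_def power_mult_distrib r(2) field_simps)
  have FX: "F X \<in> op_ball"
    using maps X by blast
  have "inner (op_inv (id_blinfun - row_sq X) (pencil X a u)) (pencil X a u)
      < (1 - (norm a)\<^sup>2) * (1 + (norm u)\<^sup>2)"
    using mult_strict_left_mono[OF less, of "r\<^sup>2"] r(1)
    unfolding u unfolding u_def pencil_scaleR op_inv_form_scaleR by (simp add: mult_ac)
  then have T: "extend_row W e u X a \<in> op_ball"
    by (rule extend_row_in_op_ball[OF W X])
  then have "extend_row W e u (F X) b \<in> op_ball"
    using maps free_holomorphic_extend_row[OF F W X a T] unfolding b_def by force
  from pencil_form_le_if_extend_row_in_op_ball[OF W FX this]
  have "r\<^sup>2 * inner (op_inv (id_blinfun - row_sq (F X)) (pencil (F X) b p)) (pencil (F X) b p)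
      \<le> r\<^sup>2 * ((1 - (norm b)\<^sup>2) * M)"
    unfolding u unfolding u_def pencil_scaleR op_inv_form_scaleR by (simp add: mult_ac)
  then show ?thesis
    using r(1) by simp
qed

section \<open>The boundary limit\<close>

lemma pencil_axis: "pencil X (axis 1 1) p = p - (X $ 1) p"
  for X :: "'h::complex_hilbert op ^ 'n::{finite,one}"
proof -
  have "(\<Sum>i\<in>UNIV. cnj (axis 1 1 $ i) *\<^sub>C (X $ i) p) =
      (\<Sum>i\<in>UNIV. if i = (1 :: 'n::{finite,one}) then (X $ 1) p else 0)"
    by (rule sum.cong) (auto simp: axis_def scaleC_one)
  then show ?thesis
    by (simp add: pencil_def)
qed

lemma tendsto_pencil:
  assumes "z \<longlonglongrightarrow> y"
  shows "(\<lambda>k. pencil X (z k) p) \<longlonglongrightarrow> pencil X y p"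
  unfolding pencil_def
  by (intro tendsto_intros scaleC.tendsto assms)

text \<open>The Schwarz-Pick inequality at \<open>z k\<close>, with the least \<open>M\<close> that it admits up to an error that
  vanishes after multiplication by \<open>1 - \<parallel>z k\<parallel>\<^sup>2\<close>. In the limit \<open>X a\<^sup>*\<close> becomes \<open>X\<^sub>1\<close>, the quotient of
  the two defects becomes \<open>L\<close>, and the competing bound \<open>\<parallel>p\<parallel>\<^sup>2 < M\<close> disappears because it is
  weighted with \<open>1 - \<parallel>z k\<parallel>\<^sup>2 \<longlonglongrightarrow> 0\<close>.\<close>

lemma Julia_form_inequality:
  fixes F :: "'h::complex_hilbert op ^ 'n::{finite,one} \<Rightarrow> 'h op ^ 'm::{finite,one}"
    and z :: "nat \<Rightarrow> complex ^ 'n::{finite,one}"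
  assumes inf: "separable_infinite_dim TYPE('h)" and F: "free_holomorphic F"
    and maps: "F ` op_ball \<subseteq> op_ball"
    and z: "\<And>k. norm (z k) < 1" "z \<longlonglongrightarrow> axis 1 1"
    and Fz: "(\<lambda>k. at_scalar F (z k)) \<longlonglongrightarrow> axis 1 1"
    and L: "(\<lambda>k. (1 - (norm (at_scalar F (z k)))\<^sup>2) / (1 - (norm (z k))\<^sup>2)) \<longlonglongrightarrow> L"
    and X: "X \<in> op_ball"
  shows "inner (op_inv (id_blinfun - row_sq (F X)) (p - (F X $ 1) p)) (p - (F X $ 1) p)
    \<le> L * inner (op_inv (id_blinfun - row_sq X) (p - (X $ 1) p)) (p - (X $ 1) p)"
proof -
  define b where "b k = at_scalar F (z k)" for k
  define Q where "Q k = inner (op_inv (id_blinfun - row_sq X) (pencil X (z k) p)) (pencil X (z k) p)" for k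
  define R where "R k = inner (op_inv (id_blinfun - row_sq (F X)) (pencil (F X) (b k) p)) (pencil (F X) (b k) p)" for k
  define Q' R' where
    "Q' = inner (op_inv (id_blinfun - row_sq X) (p - (X $ 1) p)) (p - (X $ 1) p)" and
    "R' = inner (op_inv (id_blinfun - row_sq (F X)) (p - (F X $ 1) p)) (p - (F X $ 1) p)"
  define s where "s k = 1 - (norm (z k))\<^sup>2" for k
  define t where "t k = 1 - (norm (b k))\<^sup>2" for k
  have s: "0 < s k" for k
    using z(1)[of k] by (simp add: s_def abs_square_less_1)
  have t: "0 \<le> t k" for k
  proof -
    obtain W :: "'h op" and e where W: "corank_one_isometry W e"
      using ex_corank_one_isometry[OF inf] by blast
    note e = corank_one_isometryD(2)[OF W]
    have "F (scalar_tuple (z k)) \<in> op_ball"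
      using maps scalar_tuple_in_op_ball[OF z(1)[of k]] by blast
    then have "norm (b k) < 1"
      unfolding free_holomorphic_at_scalar[OF F z(1) e] b_def[symmetric]
      by (rule norm_lt_1_if_scalar_tuple_in_op_ball[OF _ e])
    then show ?thesis
      by (simp add: t_def power_le_one)
  qed
  have Q_lim: "Q \<longlonglongrightarrow> Q'"
    unfolding Q_def Q'_def pencil_axis[symmetric]
    by (intro tendsto_inner blinfun.tendsto tendsto_const tendsto_pencil z(2))
  have R_lim: "R \<longlonglongrightarrow> R'"
    unfolding R_def R'_def pencil_axis[symmetric] b_def
    by (intro tendsto_inner blinfun.tendsto tendsto_const tendsto_pencil Fz)
  have "s \<longlonglongrightarrow> 1 - (norm (axis 1 1 :: complex ^ 'n::{finite,one}))\<^sup>2"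
    unfolding s_def by (intro tendsto_intros z(2))
  then have s_lim: "s \<longlonglongrightarrow> 0"
    by simp
  have Q'_nonneg: "0 \<le> Q'"
    unfolding Q'_def by (rule op_inv_nonneg[OF defect_positive(1,3)[OF X]])
  have step: "R k \<le> (t k / s k) * (max (Q k) (s k * (norm p)\<^sup>2) + s k)" for k
  proof -
    \<comment> \<open>The summand \<open>1\<close> makes both inequalities strict; times \<open>s k\<close> it tends to \<open>0\<close>.\<close>
    define M where "M = max (Q k / s k) ((norm p)\<^sup>2) + 1"
    have "(norm p)\<^sup>2 < M"
      by (simp add: M_def)
    moreover have "Q k < s k * M"
    proof -
      have "Q k / s k < M"
        by (simp add: M_def)
      then show ?thesis
        using s[of k] by (simp add: field_simps)
    qed
    ultimately have "R k \<le> t k * M"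
      using Schwarz_Pick_at_scalar[OF inf F maps X z(1)[of k], of p M]
      unfolding Q_def R_def s_def t_def b_def by blast
    also have "s k * M = max (Q k) (s k * (norm p)\<^sup>2) + s k"
      using s[of k] by (simp add: M_def distrib_left max_mult_distrib_left)
    then have "t k * M = (t k / s k) * (max (Q k) (s k * (norm p)\<^sup>2) + s k)"
      using s[of k] by (metis less_irrefl times_divide_eq_left times_divide_eq_right
          nonzero_mult_div_cancel_left)
    finally show ?thesis .
  qed
  have "(\<lambda>k. (t k / s k) * (max (Q k) (s k * (norm p)\<^sup>2) + s k))
      \<longlonglongrightarrow> L * (max Q' (0 * (norm p)\<^sup>2) + 0)"
    using L unfolding t_def[symmetric] s_def[symmetric] b_def[symmetric]
    by (intro tendsto_intros tendsto_max Q_lim s_lim)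
  then have "R' \<le> L * (max Q' (0 * (norm p)\<^sup>2) + 0)"
    by (rule LIMSEQ_le[OF R_lim]) (use step in blast)
  then show ?thesis
    using Q'_nonneg by (simp add: Q'_def R'_def)
qed

section \<open>The operator inequality\<close>

lemma Julia_operator:
  fixes X :: "'h::complex_hilbert op ^ 'n::{finite,one}"
  assumes X: "X \<in> op_ball"
  defines "J \<equiv> (id_blinfun - adj (X $ 1)) o\<^sub>L op_inv (id_blinfun - row_sq X) o\<^sub>L (id_blinfun - X $ 1)"
  shows "J \<in> BH"
    and "inner (J x) y = inner (op_inv (id_blinfun - row_sq X) (x - (X $ 1) x)) (y - (X $ 1) y)"
proof -
  note BH = op_ball_BH[OF X]
  show "J \<in> BH"
    unfolding J_def
    by (intro BH_intros adj_in_BH BH op_inv_apply(3) defect_positive(3)[OF X])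
  show "inner (J x) y = inner (op_inv (id_blinfun - row_sq X) (x - (X $ 1) x)) (y - (X $ 1) y)"
    by (simp add: J_def blinfun.diff_left inner_diff_left inner_diff_right inner_adj'[OF BH])
qed

section \<open>Ellipsoids\<close>

lemma ellipsoid_form:
  fixes X :: "'h::complex_hilbert op ^ 'n::{finite,one}"
  assumes BH: "\<And>i. X $ i \<in> BH"
  shows "inner (((1 / c\<^sup>2) *\<^sub>R ((X $ 1 - (1 - c) *\<^sub>R id_blinfun) o\<^sub>L (adj (X $ 1) - (1 - c) *\<^sub>R id_blinfun))
        + (\<Sum>i\<in>UNIV - {1}. (1 / c) *\<^sub>R (X $ i o\<^sub>L adj (X $ i)))) x) y
    = (1 / c\<^sup>2) * inner (adj (X $ 1) x - (1 - c) *\<^sub>R x) (adj (X $ 1) y - (1 - c) *\<^sub>R y)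
      + (1 / c) * (\<Sum>i\<in>UNIV - {1}. inner (adj (X $ i) x) (adj (X $ i) y))"
  by (simp add: blinfun.bilinear_simps blinfun.sum_left inner_add_left inner_sum_left inner_diff_left
      inner_diff_right inner_adj[OF BH] sum_distrib_left algebra_simps)

text \<open>Expanding the square of \<open>X\<^sub>1 - (1 - c) I = c I - (I - X\<^sub>1)\<close> shows that, in the inequality
  defining the ellipsoid, \<open>c\<^sup>2\<close> times the difference of the two sides is \<open>c (I - X X\<^sup>*) - (1 - c) (I - X\<^sub>1) (I - X\<^sub>1)\<^sup>*\<close>. So the ellipsoid is a horoball
  at \<open>(1, 0, \<dots>, 0)\<close>.\<close>

lemma ellipsoid_iff:
  fixes X :: "'h::complex_hilbert op ^ 'n::{finite,one}"
  assumes c: "0 < c"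
  shows "X \<in> ellipsoid c \<longleftrightarrow> (\<forall>i. X $ i \<in> BH) \<and> (\<exists>\<epsilon>>0. \<forall>h.
    (1 - c) * (norm (h - adj (X $ 1) h))\<^sup>2 + \<epsilon> * (norm h)\<^sup>2 \<le> c * inner ((id_blinfun - row_sq X) h) h)"
    (is "_ \<longleftrightarrow> _ \<and> ?R")
proof -
  define E where "E = (1 / c\<^sup>2) *\<^sub>R ((X $ 1 - (1 - c) *\<^sub>R id_blinfun) o\<^sub>L (adj (X $ 1) - (1 - c) *\<^sub>R id_blinfun))
        + (\<Sum>i\<in>UNIV - {1}. (1 / c) *\<^sub>R (X $ i o\<^sub>L adj (X $ i)))"
  have "op_less E id_blinfun \<longleftrightarrow> ?R" if BH: "\<And>i. X $ i \<in> BH"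
  proof -
    note form = ellipsoid_form[of X c, OF BH, folded E_def]
    have eq: "c\<^sup>2 * inner ((id_blinfun - E) h) h
        = c * inner ((id_blinfun - row_sq X) h) h - (1 - c) * (norm (h - adj (X $ 1) h))\<^sup>2" for h
    proof -
      define y where "y = adj (X $ 1) h"
      define s where "s = (\<Sum>i\<in>UNIV - {1}. (norm (adj (X $ i) h))\<^sup>2)"
      have "(\<Sum>i\<in>UNIV. (norm (adj (X $ i) h))\<^sup>2) = (norm y)\<^sup>2 + s"
        unfolding y_def s_def by (rule sum.remove) simp_all
      then have row: "inner ((id_blinfun - row_sq X) h) h = inner h h - inner y y - s"
        by (simp add: defect_form[OF BH] power2_norm_eq_inner)
      have "inner ((id_blinfun - E) h) h
          = inner h h - ((1 / c\<^sup>2) * inner (y - (1 - c) *\<^sub>R h) (y - (1 - c) *\<^sub>R h) + (1 / c) * s)"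
        by (simp add: blinfun.diff_left inner_diff_left form y_def s_def power2_norm_eq_inner)
      then have "c\<^sup>2 * inner ((id_blinfun - E) h) h
          = c\<^sup>2 * inner h h - inner (y - (1 - c) *\<^sub>R h) (y - (1 - c) *\<^sub>R h) - c * s"
        using c by (simp add: field_simps power2_eq_square)
      also have "\<dots> = c * (inner h h - inner y y - s) - (1 - c) * inner (h - y) (h - y)"
        by (simp add: inner_simps inner_commute algebra_simps power2_eq_square)
      finally show ?thesis
        by (simp add: row power2_norm_eq_inner y_def)
    qed
    have "coercive (id_blinfun - E) \<longleftrightarrow> ?R"
    proof
      assume "coercive (id_blinfun - E)"
      then obtain r where r: "0 < r" "\<And>h. r * (norm h)\<^sup>2 \<le> inner ((id_blinfun - E) h) h"
        unfolding coercive_def by blast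
      have "(1 - c) * (norm (h - adj (X $ 1) h))\<^sup>2 + (c\<^sup>2 * r) * (norm h)\<^sup>2
          \<le> c * inner ((id_blinfun - row_sq X) h) h" for h
        using mult_left_mono[OF r(2)[of h], of "c\<^sup>2"] eq[of h] by (simp add: mult.assoc)
      then show ?R
        using r(1) c by (intro exI[of _ "c\<^sup>2 * r"]) simp
    next
      assume ?R
      then obtain r where r: "0 < r" "\<And>h. (1 - c) * (norm (h - adj (X $ 1) h))\<^sup>2 + r * (norm h)\<^sup>2
          \<le> c * inner ((id_blinfun - row_sq X) h) h"
        by blast
      have "r / c\<^sup>2 * (norm h)\<^sup>2 \<le> inner ((id_blinfun - E) h) h" for h
        using r(2)[of h] eq[of h] c by (simp add: field_simps)
      then show "coercive (id_blinfun - E)"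
        unfolding coercive_def using r(1) c by (intro exI[of _ "r / c\<^sup>2"]) simp
    qed
    moreover have "positive_op (id_blinfun - E)" if "coercive (id_blinfun - E)"
    proof (rule positive_opI)
      show "id_blinfun - E \<in> BH"
        unfolding E_def by (intro BH_intros BH_sum adj_in_BH BH)
      have "inner (E x) y = inner (E y) x" for x y
        unfolding form by (simp only: inner_commute)
      then show "inner ((id_blinfun - E) x) y = inner x ((id_blinfun - E) y)" for x y
        by (simp add: blinfun.diff_left inner_diff_left inner_diff_right inner_commute)
      show "0 \<le> inner ((id_blinfun - E) h) h" for h
        using that unfolding coercive_def
        by (meson less_imp_le mult_nonneg_nonneg order_trans zero_le_power2)
    qed
    ultimately show ?thesis
      unfolding op_less_iff_coercive by blast
  qed
  then show ?thesis
    unfolding ellipsoid_def E_def by blast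
qed

lemma ellipsoid_subset_op_ball:
  fixes X :: "'h::complex_hilbert op ^ 'n::{finite,one}"
  assumes c: "0 < c" "c < 1" and X: "X \<in> ellipsoid c"
  shows "X \<in> op_ball"
proof -
  obtain r where r: "0 < r" "\<And>h. (1 - c) * (norm (h - adj (X $ 1) h))\<^sup>2 + r * (norm h)\<^sup>2
      \<le> c * inner ((id_blinfun - row_sq X) h) h"
    using X unfolding ellipsoid_iff[OF c(1)] by blast
  have "r / c * (norm h)\<^sup>2 \<le> inner ((id_blinfun - row_sq X) h) h" for h
  proof -
    have "0 \<le> (1 - c) * (norm (h - adj (X $ 1) h))\<^sup>2"
      using c(2) by simp
    then have "r * (norm h)\<^sup>2 \<le> c * inner ((id_blinfun - row_sq X) h) h"
      using r(2)[of h] by linarith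
    then show ?thesis
      using c(1) by (simp add: field_simps)
  qed
  then have "coercive (id_blinfun - row_sq X)"
    unfolding coercive_def using r(1) c(1) by (intro exI[of _ "r / c"]) simp
  then show ?thesis
    using X unfolding op_ball_iff_coercive ellipsoid_def by blast
qed

text \<open>A strict row contraction does not have \<open>1\<close> as an eigenvalue of its first entry. This is what
  excludes \<open>L = 0\<close>.\<close>

lemma Julia_form_pos:
  fixes X :: "'h::complex_hilbert op ^ 'n::{finite,one}"
  assumes X: "X \<in> op_ball" and p: "p \<noteq> 0"
  shows "0 < inner (op_inv (id_blinfun - row_sq X) (p - (X $ 1) p)) (p - (X $ 1) p)"
proof -
  note BH = op_ball_BH[OF X]
  define A where "A = id_blinfun - row_sq X"
  note A = defect_positive[OF X, folded A_def]
  define w where "w = p - (X $ 1) p"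
  obtain r where r: "0 < r" "\<And>h. r * (norm h)\<^sup>2 \<le> inner (A h) h"
    using A(2) unfolding coercive_def by blast
  have "w \<noteq> 0"
  proof
    assume "w = 0"
    then have "(norm p)\<^sup>2 = inner p (adj (X $ 1) p)"
      by (simp add: w_def inner_adj[OF BH, symmetric] power2_norm_eq_inner)
    also have "\<dots> \<le> norm p * norm (adj (X $ 1) p)"
      by (rule norm_cauchy_schwarz)
    finally have "norm p \<le> norm (adj (X $ 1) p)"
      using p by (simp add: power2_eq_square)
    then have "(norm p)\<^sup>2 \<le> (norm (adj (X $ 1) p))\<^sup>2"
      by (simp add: power_mono)
    also have "\<dots> \<le> (\<Sum>i\<in>UNIV. (norm (adj (X $ i) p))\<^sup>2)"
      by (rule member_le_sum) simp_all
    finally have "inner (A p) p \<le> 0"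
      by (simp add: A_def defect_form[OF BH])
    moreover have "0 < r * (norm p)\<^sup>2"
      using r(1) p by simp
    ultimately show False
      using r(2)[of p] by linarith
  qed
  define g where "g = op_inv A w"
  have Ag: "A g = w"
    by (simp add: g_def op_inv_apply(1)[OF A(3)])
  have "g \<noteq> 0"
    using Ag \<open>w \<noteq> 0\<close> by auto
  then have "0 < r * (norm g)\<^sup>2"
    using r(1) by simp
  also have "\<dots> \<le> inner w g"
    using r(2)[of g] unfolding Ag .
  finally show ?thesis
    unfolding A_def[symmetric] w_def[symmetric] g_def[symmetric] by (simp add: inner_commute)
qed

text \<open>Put \<open>\<kappa> = c / (1 - c)\<close>. Membership of \<open>X\<close> in the ellipsoid bounds \<open>(I - X\<^sub>1) (I - X\<^sub>1)\<^sup>*\<close> by a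
  multiple of \<open>I - X X\<^sup>*\<close> with a factor below \<open>\<kappa>\<close>, where the gap comes from the strictness of the
  ellipsoid. By \<open>inverse_form_le_iff\<close> the same factor bounds the form of
  \<open>(I - X\<^sub>1\<^sup>*) (I - X X\<^sup>*)\<^sup>-\<^sup>1 (I - X\<^sub>1)\<close>. The hypothesis carries this to \<open>Y\<close> at the cost of the factor
  \<open>L\<close>, and going back gives the ellipsoid of parameter \<open>\<gamma>\<close> with \<open>\<gamma> / (1 - \<gamma>) = L \<kappa>\<close>.\<close>

lemma ellipsoid_transfer:
  fixes X :: "'h::complex_hilbert op ^ 'n::{finite,one}" and Y :: "'h op ^ 'm::{finite,one}"
  assumes c: "0 < c" "c < 1" and L: "0 < L" and X: "X \<in> ellipsoid c" and Y: "Y \<in> op_ball"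
    and le: "\<And>p. inner (op_inv (id_blinfun - row_sq Y) (p - (Y $ 1) p)) (p - (Y $ 1) p)
      \<le> L * inner (op_inv (id_blinfun - row_sq X) (p - (X $ 1) p)) (p - (X $ 1) p)"
  shows "Y \<in> ellipsoid (L * c / (1 + L * c - c))"
proof -
  have XB: "X \<in> op_ball"
    by (rule ellipsoid_subset_op_ball[OF c X])
  define A B where "A = id_blinfun - row_sq X" and "B = id_blinfun - row_sq Y"
  note A = defect_positive[OF XB, folded A_def]
  note B = defect_positive[OF Y, folded B_def]
  obtain r0 where r0: "0 < r0" "\<And>h. (1 - c) * (norm (h - adj (X $ 1) h))\<^sup>2 + r0 * (norm h)\<^sup>2
      \<le> c * inner (A h) h"
    using X unfolding ellipsoid_iff[OF c(1)] A_def by blast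
  \<comment> \<open>Truncated at \<open>c\<close> to keep the factor \<open>k\<close> below nonnegative.\<close>
  define r where "r = min r0 c"
  have r: "0 < r" "r \<le> c"
    using r0(1) c(1) by (simp_all add: r_def)
  define k where "k = (c - r) / (1 - c)"
  have k: "0 \<le> k"
    using r c by (simp add: k_def)
  have adj_diff: "adj (id_blinfun - T) h = h - adj T h" if "T \<in> BH" for T :: "'h op" and h
    by (rule adj_apply_eqI)
      (simp_all add: BH_intros that blinfun.diff_left cinner.diff_left cinner.diff_right cinner_adj)
  have "(norm (h - adj (X $ 1) h))\<^sup>2 \<le> k * inner (A h) h" for h
  proof -
    have "inner (A h) h \<le> (norm h)\<^sup>2"
      by (simp add: A_def defect_form[OF op_ball_BH[OF XB]] sum_nonneg)
    then have "r * inner (A h) h \<le> r * (norm h)\<^sup>2"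
      using r(1) by simp
    also have "\<dots> \<le> r0 * (norm h)\<^sup>2"
      by (intro mult_right_mono) (simp_all add: r_def)
    finally have "(1 - c) * (norm (h - adj (X $ 1) h))\<^sup>2 \<le> (c - r) * inner (A h) h"
      using r0(2)[of h] by (simp add: algebra_simps)
    then show ?thesis
      using c(2) by (simp add: k_def field_simps)
  qed
  then have "\<forall>h. (norm (adj (id_blinfun - X $ 1) h))\<^sup>2 \<le> k * inner (A h) h"
    by (simp add: adj_diff op_ball_BH[OF XB])
  then have "inner (op_inv A (p - (X $ 1) p)) (p - (X $ 1) p) \<le> k * (norm p)\<^sup>2" for p
    using inverse_form_le_iff[OF A(1,3) _ k, of "id_blinfun - X $ 1"]
    by (simp add: BH_intros op_ball_BH[OF XB] blinfun.diff_left)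
  then have "inner (op_inv B (p - (Y $ 1) p)) (p - (Y $ 1) p) \<le> (L * k) * (norm p)\<^sup>2" for p
    using order_trans[OF le[folded A_def B_def] mult_left_mono] L by (simp add: mult.assoc)
  then have "\<forall>h. (norm (adj (id_blinfun - Y $ 1) h))\<^sup>2 \<le> (L * k) * inner (B h) h"
    using inverse_form_le_iff[OF B(1,3), of "id_blinfun - Y $ 1" "L * k"] k L
    by (simp add: BH_intros op_ball_BH[OF Y] blinfun.diff_left)
  then have Y_le: "(norm (h - adj (Y $ 1) h))\<^sup>2 \<le> (L * k) * inner (B h) h" for h
    by (simp add: adj_diff op_ball_BH[OF Y])
  obtain d where d: "0 < d" "\<And>h. d * (norm h)\<^sup>2 \<le> inner (B h) h"
    using B(2) unfolding coercive_def by blast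
  define D where "D = 1 + L * c - c"
  have D: "0 < D"
    using mult_pos_pos[OF L c(1)] c(2) by (simp add: D_def)
  have D': "1 - L * c / D = (1 - c) / D"
    using D by (simp add: D_def field_simps)
  have "(1 - L * c / D) * (norm (h - adj (Y $ 1) h))\<^sup>2 + (L * r * d / D) * (norm h)\<^sup>2
      \<le> L * c / D * inner (B h) h" for h
  proof -
    have "(1 - c) * (norm (h - adj (Y $ 1) h))\<^sup>2 \<le> (1 - c) * ((L * k) * inner (B h) h)"
      using c(2) by (intro mult_left_mono Y_le) simp
    also have "\<dots> = L * (c - r) * inner (B h) h"
      using c(2) by (simp add: k_def)
    finally have "(1 - c) * (norm (h - adj (Y $ 1) h))\<^sup>2 + (L * r) * inner (B h) h
        \<le> L * c * inner (B h) h"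
      by (simp add: algebra_simps)
    moreover have "(L * r) * (d * (norm h)\<^sup>2) \<le> (L * r) * inner (B h) h"
      using L r(1) by (intro mult_left_mono d(2)) simp
    ultimately have "((1 - c) * (norm (h - adj (Y $ 1) h))\<^sup>2 + (L * r * d) * (norm h)\<^sup>2) / D
        \<le> (L * c * inner (B h) h) / D"
      using D by (intro divide_right_mono) (simp_all add: mult.assoc)
    then show ?thesis
      unfolding D' by (simp add: add_divide_distrib)
  qed
  moreover have "0 < L * r * d / D" "0 < L * c / D"
    using L r d D c by simp_all
  ultimately show ?thesis
    unfolding D_def[symmetric] ellipsoid_iff[OF \<open>0 < L * c / D\<close>] B_def[symmetric]
    using op_ball_BH[OF Y] by blast
qed

theorem theorem6p4:
  fixes F :: "'h::complex_hilbert op ^ 'n::{finite,one} \<Rightarrow> 'h op ^ 'm::{finite,one}"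
    and z :: "nat \<Rightarrow> complex ^ 'n::{finite,one}"
    and L :: real
  assumes "separable_infinite_dim TYPE('h)"
    and "free_holomorphic F"
    and "F ` op_ball \<subseteq> op_ball"
    and "\<And>k. z k \<in> ball 0 1"
    and "z \<longlonglongrightarrow> axis 1 1"
    and "(\<lambda>k. at_scalar F (z k)) \<longlonglongrightarrow> axis 1 1"
    and "(\<lambda>k. (1 - (norm (at_scalar F (z k)))\<^sup>2) / (1 - (norm (z k))\<^sup>2)) \<longlonglongrightarrow> L"
  shows "(\<forall>X\<in>op_ball.
            op_le
              ((id_blinfun - adj (F X $ 1)) o\<^sub>L op_inv (id_blinfun - row_sq (F X))
                o\<^sub>L (id_blinfun - F X $ 1))
              (L *\<^sub>R ((id_blinfun - adj (X $ 1)) o\<^sub>L op_inv (id_blinfun - row_sq X)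
                o\<^sub>L (id_blinfun - X $ 1))))
       \<and> (\<forall>c. 0 < c \<and> c < 1 \<longrightarrow>
            F ` ellipsoid c \<subseteq> ellipsoid (L * c / (1 + L * c - c)))"
proof -
  have z: "norm (z k) < 1" for k
    using assms(4)[of k] by simp
  have FX: "F X \<in> op_ball" if "X \<in> op_ball" for X
    using assms(3) that by blast
  note form_le = Julia_form_inequality[OF assms(1-3) z assms(5-7)]
  show ?thesis
  proof (intro conjI ballI allI impI)
    fix X :: "'h op ^ 'n::{finite,one}"
    assume X: "X \<in> op_ball"
    show "op_le
        ((id_blinfun - adj (F X $ 1)) o\<^sub>L op_inv (id_blinfun - row_sq (F X)) o\<^sub>L (id_blinfun - F X $ 1))
        (L *\<^sub>R ((id_blinfun - adj (X $ 1)) o\<^sub>L op_inv (id_blinfun - row_sq X) o\<^sub>L (id_blinfun - X $ 1)))"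
      (is "op_le ?J (L *\<^sub>R ?K)")
      unfolding op_le_def
    proof (rule positive_opI)
      show "L *\<^sub>R ?K - ?J \<in> BH"
        by (intro BH_intros(3,5) Julia_operator(1) X FX)
      fix x y :: 'h
      have form: "inner ((L *\<^sub>R ?K - ?J) x) y
          = L * inner (op_inv (id_blinfun - row_sq X) (x - (X $ 1) x)) (y - (X $ 1) y)
            - inner (op_inv (id_blinfun - row_sq (F X)) (x - (F X $ 1) x)) (y - (F X $ 1) y)" for x y
        unfolding blinfun.diff_left blinfun.scaleR_left inner_diff_left inner_scaleR_left
          Julia_operator(2)[OF X] Julia_operator(2)[OF FX[OF X]] ..
      show "inner ((L *\<^sub>R ?K - ?J) x) y = inner x ((L *\<^sub>R ?K - ?J) y)"
        unfolding inner_commute[of x] form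
        using op_inv_symmetric[OF defect_positive(1,3)[OF X], of "x - (X $ 1) x" "y - (X $ 1) y"]
          op_inv_symmetric[OF defect_positive(1,3)[OF FX[OF X]], of "x - (F X $ 1) x" "y - (F X $ 1) y"]
        by (simp add: inner_commute)
      show "0 \<le> inner ((L *\<^sub>R ?K - ?J) x) x"
        unfolding form using form_le[OF X] by simp
    qed
  next
    fix c :: real
    assume c: "0 < c \<and> c < 1"
    show "F ` ellipsoid c \<subseteq> ellipsoid (L * c / (1 + L * c - c))"
    proof (rule image_subsetI)
      fix X :: "'h op ^ 'n::{finite,one}"
      assume X: "X \<in> ellipsoid c"
      then have XB: "X \<in> op_ball"
        using c by (intro ellipsoid_subset_op_ball) simp_all
      obtain W :: "'h op" and e where "corank_one_isometry W e"
        using ex_corank_one_isometry[OF assms(1)] by blast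
      then have "e \<noteq> 0"
        using corank_one_isometryD(2) by (force simp: cinner.zero_left)
      then have "0 < L * inner (op_inv (id_blinfun - row_sq X) (e - (X $ 1) e)) (e - (X $ 1) e)"
        using Julia_form_pos[OF FX[OF XB]] form_le[OF XB] less_le_trans by blast
      then have "0 < L"
        using Julia_form_pos[OF XB \<open>e \<noteq> 0\<close>] by (simp add: zero_less_mult_iff)
      then show "F X \<in> ellipsoid (L * c / (1 + L * c - c))"
        using c by (intro ellipsoid_transfer[OF _ _ _ X FX[OF XB] form_le[OF XB]]) simp_all
    qed
  qed
qed

end
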